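(* Let $X_1$ and $X_2$ be Banach spaces and let $\alpha_1$ and $\alpha_2$ be isometric automorphisms of $X_1$ and $X_2$, respectively. Suppose there is an isomorphism $\gamma:X_1\to X_2$ such that $\gamma\circ\alpha_1=\alpha_2\circ\gamma$. Then $\mathrm{hc}(\alpha_1)=0$ if and only if $\mathrm{hc}(\alpha_2)=0$.
   Context: All Banach spaces are over $\mathbb{C}$. An isomorphism of Banach spaces is a bounded linear bijection with bounded inverse (not necessarily isometric). CA entropy: For a bounded linear map $\gamma:X\to Y$ of Banach spaces, a finite set $\Omega\subseteq X$ and $\delta>0$, let $\mathrm{CA}(\gamma,\Omega,\delta)$ be the collection of triples $(\phi,\psi,d)$ where $d$ is a positive integer and $\phi:X\to\ell_\infty^d$, $\psi:\ell_\infty^d\to Y$ are contractive (norm $\le1$) linear maps with $\|\psi\circ\phi(x)-\gamma(x)\|<\delta$ for all $x\in\Omega$. A CA embedding of $X$ is an isometric linear map $\iota$ from $X$ into a Banach space $Y$ such that $\mathrm{CA}(\iota,\Omega,\delta)\neq\emptyset$ for all finite $\Omega\subseteq X$ and $\delta>0$; every Banach space has one (e.g. the evaluation map $X\to C(B_1(X^* ))$, where $B_1(X^* )$ is the weak$^*$ compact unit ball of the dual). Set $\mathrm{rc}(\Omega,\delta)=\inf\{d:(\phi,\psi,d)\in\mathrm{CA}(\iota,\Omega,\delta)\}$, which does not depend on the CA embedding $\iota$. For an isometric (surjective linear) automorphism $\alpha$ of $X$ put $\mathrm{hc}(\alpha,\Omega,\delta)=\limsup_{n\to\infty}\frac1n\log\mathrm{rc}(\Omega\cup\alpha\Omega\cup\cdots\cup\alpha^{n-1}\Omega,\delta)$,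 $\mathrm{hc}(\alpha,\Omega)=\sup_{\delta>0}\mathrm{hc}(\alpha,\Omega,\delta)$, and $\mathrm{hc}(\alpha)=\sup_\Omega\mathrm{hc}(\alpha,\Omega)$ over finite $\Omega\subseteq X$. *)

theory Defs
  imports "HOL-Analysis.Analysis" "HOL-Probability.Discrete_Topology"
begin

section \<open>Complex Banach spaces\<close>

class complex_banach = banach +
  fixes scaleC :: "complex \<Rightarrow> 'a \<Rightarrow> 'a" (infixr "*\<^sub>C" 75)
  assumes scaleC_add_right: "a *\<^sub>C (x + y) = a *\<^sub>C x + a *\<^sub>C y"
    and scaleC_add_left: "(a + b) *\<^sub>C x = a *\<^sub>C x + b *\<^sub>C x"
    and scaleC_scaleC: "a *\<^sub>C (b *\<^sub>C x) = (a * b) *\<^sub>C x"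
    and scaleR_eq_scaleC: "r *\<^sub>R x = complex_of_real r *\<^sub>C x"
    and norm_scaleC: "norm (a *\<^sub>C x) = cmod a * norm x"

definition bounded_clinear :: "('a::complex_banach \<Rightarrow> 'b::complex_banach) \<Rightarrow> bool" where
  "bounded_clinear f \<longleftrightarrow> bounded_linear f \<and> (\<forall>c x. f (c *\<^sub>C x) = c *\<^sub>C f x)"

definition banach_isomorphism :: "('a::complex_banach \<Rightarrow> 'b::complex_banach) \<Rightarrow> bool" where
  "banach_isomorphism f \<longleftrightarrow> bounded_clinear f \<and> bij f \<and> bounded_clinear (inv f)"

definition isometric_embedding :: "('a::complex_banach \<Rightarrow> 'b::complex_banach) \<Rightarrow> bool" where
  "isometric_embedding f \<longleftrightarrow> bounded_clinear f \<and> (\<forall>x. norm (f x) = norm x)"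

definition isometric_automorphism :: "('a::complex_banach \<Rightarrow> 'a) \<Rightarrow> bool" where
  "isometric_automorphism f \<longleftrightarrow> isometric_embedding f \<and> surj f"


section \<open>CA entropy\<close>

text \<open>Since \<open>d\<close> is quantified inside the definitions, \<open>\<ell>\<^sub>\<infinity>\<^sup>d\<close> is the carrier set of complex
  sequences vanishing from index \<open>d\<close> on, with the maximum norm (meaningful for \<open>d > 0\<close> only).\<close>

definition linf :: "nat \<Rightarrow> (nat \<Rightarrow> complex) set" where
  "linf d = {v. \<forall>i\<ge>d. v i = 0}"

definition linf_norm :: "nat \<Rightarrow> (nat \<Rightarrow> complex) \<Rightarrow> real" where
  "linf_norm d v = Max ((\<lambda>i. cmod (v i)) ` {..<d})"

definition contraction_to_linf :: "nat \<Rightarrow> ('a::complex_banach \<Rightarrow> nat \<Rightarrow> complex) \<Rightarrow> bool" where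
  "contraction_to_linf d \<phi> \<longleftrightarrow>
     (\<forall>x. \<phi> x \<in> linf d) \<and>
     (\<forall>x y. \<phi> (x + y) = (\<lambda>i. \<phi> x i + \<phi> y i)) \<and>
     (\<forall>c x. \<phi> (c *\<^sub>C x) = (\<lambda>i. c * \<phi> x i)) \<and>
     (\<forall>x. linf_norm d (\<phi> x) \<le> norm x)"

definition contraction_from_linf :: "nat \<Rightarrow> ((nat \<Rightarrow> complex) \<Rightarrow> 'b::complex_banach) \<Rightarrow> bool" where
  "contraction_from_linf d \<psi> \<longleftrightarrow>
     (\<forall>v\<in>linf d. \<forall>w\<in>linf d. \<psi> (\<lambda>i. v i + w i) = \<psi> v + \<psi> w) \<and>
     (\<forall>c. \<forall>v\<in>linf d. \<psi> (\<lambda>i. c * v i) = c *\<^sub>C \<psi> v) \<and>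
     (\<forall>v\<in>linf d. norm (\<psi> v) \<le> linf_norm d v)"

definition CA :: "('a::complex_banach \<Rightarrow> 'b::complex_banach) \<Rightarrow> 'a set \<Rightarrow> real \<Rightarrow>
    (('a \<Rightarrow> nat \<Rightarrow> complex) \<times> ((nat \<Rightarrow> complex) \<Rightarrow> 'b) \<times> nat) set" where
  "CA \<gamma> \<Omega> \<delta> = {(\<phi>, \<psi>, d). d > 0 \<and> contraction_to_linf d \<phi> \<and> contraction_from_linf d \<psi> \<and>
     (\<forall>x\<in>\<Omega>. norm (\<psi> (\<phi> x) - \<gamma> x) < \<delta>)}"

definition CA_embedding :: "('a::complex_banach \<Rightarrow> 'b::complex_banach) \<Rightarrow> bool" where
  "CA_embedding \<iota> \<longleftrightarrow> isometric_embedding \<iota> \<and> (\<forall>\<Omega> \<delta>. finite \<Omega> \<longrightarrow> \<delta> > 0 \<longrightarrow> CA \<iota> \<Omega> \<delta> \<noteq> {})"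

text \<open>The quantities below do not depend on the CA embedding \<open>\<iota>\<close>, which is kept as a parameter
  because it may take values in an arbitrary Banach space. For a CA embedding, finite \<open>\<Omega>\<close> and
  \<open>\<delta> > 0\<close>, the infimum in \<open>rc\<close> is over a nonempty set of positive integers.\<close>

definition rc :: "('a::complex_banach \<Rightarrow> 'b::complex_banach) \<Rightarrow> 'a set \<Rightarrow> real \<Rightarrow> nat" where
  "rc \<iota> \<Omega> \<delta> = Inf {d. \<exists>\<phi> \<psi>. (\<phi>, \<psi>, d) \<in> CA \<iota> \<Omega> \<delta>}"

definition hc_delta ::
    "('a::complex_banach \<Rightarrow> 'b::complex_banach) \<Rightarrow> ('a \<Rightarrow> 'a) \<Rightarrow> 'a set \<Rightarrow> real \<Rightarrow> ereal" where
  "hc_delta \<iota> \<alpha> \<Omega> \<delta> =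
     limsup (\<lambda>n. ereal (ln (real (rc \<iota> (\<Union>k<n. (\<alpha> ^^ k) ` \<Omega>) \<delta>)) / real n))"

definition hc_set ::
    "('a::complex_banach \<Rightarrow> 'b::complex_banach) \<Rightarrow> ('a \<Rightarrow> 'a) \<Rightarrow> 'a set \<Rightarrow> ereal" where
  "hc_set \<iota> \<alpha> \<Omega> = (SUP \<delta>\<in>{0<..}. hc_delta \<iota> \<alpha> \<Omega> \<delta>)"

definition hc :: "('a::complex_banach \<Rightarrow> 'b::complex_banach) \<Rightarrow> ('a \<Rightarrow> 'a) \<Rightarrow> ereal" where
  "hc \<iota> \<alpha> = (SUP \<Omega>\<in>{\<Omega>. finite \<Omega>}. hc_set \<iota> \<alpha> \<Omega>)"


section \<open>Every complex Banach space has a CA embedding\<close>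

subsection \<open>The target space\<close>

instantiation complex :: complex_banach
begin
definition scaleC_complex :: "complex \<Rightarrow> complex \<Rightarrow> complex" where
  "scaleC_complex a x = a * x"
instance
  by standard (auto simp: scaleC_complex_def algebra_simps norm_mult scaleR_conv_of_real)
end

lemma scaleC_bounded_linear: "bounded_linear (\<lambda>x::'a::complex_banach. c *\<^sub>C x)"
proof (rule bounded_linear_intro[where K = "cmod c"])
  show "c *\<^sub>C (r *\<^sub>R x) = r *\<^sub>R (c *\<^sub>C x)" for r and x :: 'a
    by (simp add: scaleR_eq_scaleC scaleC_scaleC mult.commute)
qed (simp_all add: scaleC_add_right norm_scaleC mult.commute)

instantiation bcontfun :: (metric_space, complex_banach) complex_banach
begin

definition scaleC_bcontfun :: "complex \<Rightarrow> ('a \<Rightarrow>\<^sub>C 'b) \<Rightarrow> ('a \<Rightarrow>\<^sub>C 'b)" where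
  "scaleC_bcontfun c f = Bcontfun (\<lambda>x. c *\<^sub>C apply_bcontfun f x)"

lemma scaleC_bcontfun_apply:
  fixes f :: "'a \<Rightarrow>\<^sub>C 'b"
  shows "apply_bcontfun (c *\<^sub>C f) x = c *\<^sub>C apply_bcontfun f x"
proof -
  have "bounded (range (\<lambda>x. c *\<^sub>C apply_bcontfun f x))"
    using bounded_linear_image[OF bounded_apply_bcontfun[of f] scaleC_bounded_linear[of c]]
    by (simp add: image_image)
  moreover have "continuous_on UNIV (\<lambda>x. c *\<^sub>C apply_bcontfun f x)"
    by (rule bounded_linear.continuous_on[OF scaleC_bounded_linear continuous_on_apply_bcontfun])
  ultimately have "(\<lambda>x. c *\<^sub>C apply_bcontfun f x) \<in> bcontfun" by (simp add: bcontfun_def)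
  then show ?thesis by (simp add: scaleC_bcontfun_def Bcontfun_inverse)
qed

instance
proof
  fix a b :: complex and r :: real and x y :: "'a \<Rightarrow>\<^sub>C 'b"
  show "a *\<^sub>C (x + y) = a *\<^sub>C x + a *\<^sub>C y"
    by (intro bcontfun_eqI) (simp add: scaleC_bcontfun_apply scaleC_add_right)
  show "(a + b) *\<^sub>C x = a *\<^sub>C x + b *\<^sub>C x"
    by (intro bcontfun_eqI) (simp add: scaleC_bcontfun_apply scaleC_add_left)
  show "a *\<^sub>C (b *\<^sub>C x) = (a * b) *\<^sub>C x"
    by (intro bcontfun_eqI) (simp add: scaleC_bcontfun_apply scaleC_scaleC)
  show "r *\<^sub>R x = complex_of_real r *\<^sub>C x"
    by (intro bcontfun_eqI) (simp add: scaleC_bcontfun_apply scaleR_eq_scaleC)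
  have le: "norm (c *\<^sub>C f) \<le> cmod c * norm f" for c and f :: "'a \<Rightarrow>\<^sub>C 'b"
    by (intro norm_bound)
      (simp add: scaleC_bcontfun_apply norm_scaleC mult_left_mono norm_bounded)
  show "norm (a *\<^sub>C x) = cmod a * norm x"
  proof (cases "a = 0")
    case True
    then show ?thesis using le[of a x] by simp
  next
    case False
    have "inverse a *\<^sub>C (a *\<^sub>C x) = x"
      using False by (intro bcontfun_eqI)
        (simp add: scaleC_bcontfun_apply scaleC_scaleC flip: scaleR_eq_scaleC[of 1, simplified])
    then have "norm x \<le> cmod (inverse a) * norm (a *\<^sub>C x)"
      using le[of "inverse a" "a *\<^sub>C x"] by simp
    then have "cmod a * norm x \<le> norm (a *\<^sub>C x)"
      using False by (simp add: norm_inverse inverse_eq_divide[of "cmod a"] pos_le_divide_eq mult.commute)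
    with le[of a x] show ?thesis by simp
  qed
qed

end

subsection \<open>Norming functionals\<close>

definition sublin :: "('a::real_vector \<Rightarrow> real) \<Rightarrow> bool" where
  "sublin p \<longleftrightarrow> (\<forall>x y. p (x + y) \<le> p x + p y) \<and> (\<forall>c x. c > 0 \<longrightarrow> p (c *\<^sub>R x) = c * p x)"

lemma sublin_zero: "sublin p \<Longrightarrow> p 0 = 0"
proof -
  assume "sublin p"
  then have "p (2 *\<^sub>R 0) = 2 * p 0" unfolding sublin_def by (metis zero_less_numeral)
  then show ?thesis by simp
qed

lemma sublin_scale: "sublin p \<Longrightarrow> c \<ge> 0 \<Longrightarrow> p (c *\<^sub>R x) = c * p x"
  using sublin_zero[of p] by (cases "c = 0") (auto simp: sublin_def)

lemma sublin_lower: "sublin p \<Longrightarrow> - p (- x) \<le> p x"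
proof -
  assume p: "sublin p"
  then have "p (x + - x) \<le> p x + p (- x)" unfolding sublin_def by blast
  with sublin_zero[OF p] show ?thesis by simp
qed

text \<open>A sublinear functional can be lowered so as to become linear on the line through \<open>z\<close>.\<close>

lemma sublin_reduce:
  fixes p :: "'a::real_vector \<Rightarrow> real"
  assumes p: "sublin p"
  obtains q where "sublin q" "q \<le> p" "q (- z) \<le> - p z" "\<And>y. q y \<le> p (y + z) - p z"
proof -
  define h where "h = (\<lambda>y t. p (y + t *\<^sub>R z) - t * p z)"
  define q where "q = (\<lambda>y. INF t\<in>{0..}. h y t)"
  have low: "- p (- y) \<le> h y t" if "t \<ge> 0" for y t
  proof -
    have "p (t *\<^sub>R z) \<le> p (y + t *\<^sub>R z) + p (- y)"
      using p unfolding sublin_def by (metis add.commute add_uminus_conv_diff add_diff_cancel)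
    then show ?thesis using sublin_scale[OF p that] by (simp add: h_def)
  qed
  have bdd: "bdd_below (h y ` {0..})" for y
    using low by (intro bdd_belowI2[where m = "- p (- y)"]) auto
  have qle: "q y \<le> h y t" if "t \<ge> 0" for y t
    unfolding q_def using bdd that by (intro cINF_lower) auto
  have qge: "b \<le> q y" if "\<And>t. t \<ge> 0 \<Longrightarrow> b \<le> h y t" for y b
    unfolding q_def using that by (intro cINF_greatest) auto
  have add: "q (x + y) \<le> q x + q y" for x y
  proof -
    have "q (x + y) - h y t \<le> h x s" if "s \<ge> 0" "t \<ge> 0" for s t
    proof -
      have "q (x + y) \<le> h (x + y) (s + t)" using that by (intro qle) simp
      also have "\<dots> = p ((x + s *\<^sub>R z) + (y + t *\<^sub>R z)) - (s + t) * p z"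
        by (simp add: h_def algebra_simps)
      also have "\<dots> \<le> p (x + s *\<^sub>R z) + p (y + t *\<^sub>R z) - (s + t) * p z"
        using p unfolding sublin_def by simp
      also have "\<dots> = h x s + h y t" by (simp add: h_def algebra_simps)
      finally show ?thesis by simp
    qed
    then have "q (x + y) - h y t \<le> q x" if "t \<ge> 0" for t using that by (intro qge) auto
    then have "q (x + y) - q x \<le> h y t" if "t \<ge> 0" for t using that by (simp add: algebra_simps)
    then have "q (x + y) - q x \<le> q y" by (intro qge)
    then show ?thesis by simp
  qed
  have hom_le: "q (c *\<^sub>R x) \<le> c * q x" if "c > 0" for c x
  proof -
    have "q (c *\<^sub>R x) / c \<le> h x t" if "t \<ge> 0" for t
    proof -
      have "q (c *\<^sub>R x) \<le> h (c *\<^sub>R x) (c * t)" using that \<open>c > 0\<close> by (intro qle) simp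
      also have "\<dots> = p (c *\<^sub>R (x + t *\<^sub>R z)) - c * t * p z"
        by (simp add: h_def scaleR_add_right)
      also have "\<dots> = c * h x t"
        using sublin_scale[OF p, of c "x + t *\<^sub>R z"] \<open>c > 0\<close> by (simp add: h_def right_diff_distrib)
      finally show ?thesis using \<open>c > 0\<close> by (simp add: field_simps)
    qed
    then have "q (c *\<^sub>R x) / c \<le> q x" by (intro qge)
    then show ?thesis using \<open>c > 0\<close> by (simp add: field_simps)
  qed
  have hom: "q (c *\<^sub>R x) = c * q x" if "c > 0" for c x
  proof -
    have "q (inverse c *\<^sub>R (c *\<^sub>R x)) \<le> inverse c * q (c *\<^sub>R x)" using that by (intro hom_le) simp
    then have "c * q x \<le> q (c *\<^sub>R x)" using that by (simp add: field_simps)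
    with hom_le[OF that, of x] show ?thesis by simp
  qed
  show ?thesis
  proof
    show "sublin q" using add hom by (simp add: sublin_def)
    show "q \<le> p" using qle[of 0] by (auto simp: le_fun_def h_def)
    show "q (- z) \<le> - p z" using qle[of 1 "- z"] sublin_zero[OF p] by (simp add: h_def)
    show "q y \<le> p (y + z) - p z" for y using qle[of 1 y] by (simp add: h_def)
  qed
qed

lemma sublin_norm: "sublin (norm :: 'a::real_normed_vector \<Rightarrow> real)"
  by (auto simp: sublin_def norm_triangle_ineq)

lemma sublin_dominates_linear:
  fixes p0 :: "'a::real_vector \<Rightarrow> real"
  assumes p0: "sublin p0"
  obtains u where "linear u" "u \<le> p0"
proof -
  define A where "A = {p. sublin p \<and> p \<le> p0}"
  have "\<exists>m\<in>A. \<forall>a\<in>A. a \<le> m \<longrightarrow> a = m"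
  proof (rule predicate_Zorn[where P = "\<lambda>p q. q \<le> p"])
    show "partial_order_on A (relation_of (\<lambda>p q. q \<le> p) A)"
      by (rule partial_order_on_relation_ofI) auto
    fix C assume "C \<in> Chains (relation_of (\<lambda>p q. q \<le> p) A)"
    then have CA: "C \<subseteq> A" and chain: "\<And>p q. p \<in> C \<Longrightarrow> q \<in> C \<Longrightarrow> p \<le> q \<or> q \<le> p"
      by (auto simp: Chains_def relation_of_def)
    show "\<exists>u\<in>A. \<forall>a\<in>C. u \<le> a"
    proof (cases "C = {}")
      case True
      then show ?thesis using p0 by (auto simp: A_def)
    next
      case False
      define u where "u = (\<lambda>x. INF p\<in>C. p x)"
      have sub: "sublin p" "p \<le> p0" if "p \<in> C" for p using CA that by (auto simp: A_def)
      have low: "- p0 (- x) \<le> p x" if "p \<in> C" for p x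
        using sublin_lower[OF sub(1)[OF that], of x] sub(2)[OF that] 
        by (meson le_funD le_imp_neg_le order_trans)
      have ule: "u x \<le> p x" if "p \<in> C" for p x
        unfolding u_def using low that by (intro cINF_lower bdd_belowI2[where m = "- p0 (- x)"]) auto
      have uge: "b \<le> u x" if "\<And>p. p \<in> C \<Longrightarrow> b \<le> p x" for b x
        unfolding u_def using that False by (intro cINF_greatest) auto
      have add: "u (x + y) \<le> u x + u y" for x y
      proof -
        have "u (x + y) - q y \<le> p x" if "p \<in> C" "q \<in> C" for p q
        proof -
          have "\<exists>r\<in>C. r \<le> p \<and> r \<le> q" using chain[OF that] that by blast
          then obtain r where r: "r \<in> C" "r \<le> p" "r \<le> q" by blast
          have "u (x + y) \<le> r (x + y)" using ule r by blast
          also have "\<dots> \<le> r x + r y" using sub(1)[OF r(1)] by (simp add: sublin_def)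
          also have "\<dots> \<le> p x + q y" using r by (intro add_mono) (auto simp: le_fun_def)
          finally show ?thesis by simp
        qed
        then have "u (x + y) - q y \<le> u x" if "q \<in> C" for q using that by (intro uge) auto
        then have "u (x + y) - u x \<le> q y" if "q \<in> C" for q using that by (simp add: algebra_simps)
        then have "u (x + y) - u x \<le> u y" by (intro uge)
        then show ?thesis by simp
      qed
      have hom: "u (c *\<^sub>R x) = c * u x" if "c > 0" for c x
      proof (rule antisym)
        have "u (c *\<^sub>R x) / c \<le> p x" if "p \<in> C" for p
          using ule[OF that, of "c *\<^sub>R x"] sublin_scale[OF sub(1)[OF that], of c x] \<open>c > 0\<close>
          by (simp add: field_simps)
        then have "u (c *\<^sub>R x) / c \<le> u x" by (intro uge)
        then show "u (c *\<^sub>R x) \<le> c * u x" using that by (simp add: field_simps)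
        show "c * u x \<le> u (c *\<^sub>R x)"
        proof (rule uge)
          fix p assume "p \<in> C"
          then show "c * u x \<le> p (c *\<^sub>R x)"
            using ule[of p x] sublin_scale[OF sub(1), of p c x] that by simp
        qed
      qed
      obtain p where "p \<in> C" using False by blast
      then have "u \<le> p0" using ule sub(2) by (meson le_fun_def order_trans)
      then have "u \<in> A" using add hom by (simp add: A_def sublin_def)
      then show ?thesis using ule by (auto simp: le_fun_def)
    qed
  qed
  then obtain m where m: "sublin m" "m \<le> p0" and min: "\<And>a. sublin a \<Longrightarrow> a \<le> m \<Longrightarrow> a = m"
    unfolding A_def by (auto intro: order_trans)
  have sup: "m y + m z \<le> m (y + z)" for y z
  proof -
    obtain q where q: "sublin q" "q \<le> m" "\<And>y. q y \<le> m (y + z) - m z"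
      using sublin_reduce[OF m(1)] by metis
    then have "m y \<le> m (y + z) - m z" using min by metis
    then show ?thesis by simp
  qed
  have add: "m (y + z) = m y + m z" for y z
    using sup[of y z] m(1) by (auto simp: sublin_def intro: antisym)
  have neg: "m (- x) = - m x" for x
    using add[of x "- x"] sublin_zero[OF m(1)] by simp
  have scale: "m (c *\<^sub>R x) = c * m x" for c x
  proof (cases "c \<ge> 0")
    case True
    then show ?thesis using sublin_scale[OF m(1)] by simp
  next
    case False
    then have "m (- c *\<^sub>R x) = - c * m x" by (intro sublin_scale[OF m(1)]) simp
    then show ?thesis using neg[of "c *\<^sub>R x"] by simp
  qed
  have "linear m" by (rule linearI) (simp_all add: add scale)
  then show ?thesis using that m(2) by blast
qed

text \<open>The unit ball of the dual of \<open>'a\<close>.\<close>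

definition dual_ball :: "('a::complex_banach \<Rightarrow> complex) set" where
  "dual_ball = {f. (\<forall>x y. f (x + y) = f x + f y) \<and> (\<forall>c x. f (c *\<^sub>C x) = c * f x) \<and>
     (\<forall>x. cmod (f x) \<le> norm x)}"

lemma norming_functional:
  fixes x :: "'a::complex_banach"
  obtains f where "f \<in> dual_ball" "norm x \<le> cmod (f x)"
proof -
  obtain q where q: "sublin q" "q \<le> (norm :: 'a \<Rightarrow> real)" "q (- x) \<le> - norm x"
    using sublin_reduce[OF sublin_norm] by metis
  obtain u where u: "linear u" "u \<le> q" using sublin_dominates_linear[OF q(1)] .
  interpret u: linear u by (fact u(1))
  have ux: "norm x \<le> u x" using u(2) q(3) u.neg[of x] by (fastforce dest: le_funD[of _ _ "- x"])
  have un: "u y \<le> norm y" for y using u(2) q(2) by (meson le_funD order_trans)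
  define f where "f y = Complex (u y) (- u (\<i> *\<^sub>C y))" for y
  have one: "1 *\<^sub>C y = y" for y :: 'a by (metis scaleR_eq_scaleC of_real_1 scaleR_one)
  have add: "f (y + z) = f y + f z" for y z
    by (simp add: f_def u.add scaleC_add_right complex_eq_iff)
  have scale: "f (c *\<^sub>C y) = c * f y" for c y
  proof -
    have e: "u (c *\<^sub>C y) = Re c * u y + Im c * u (\<i> *\<^sub>C y)" for c y
    proof -
      have "c *\<^sub>C y = (complex_of_real (Re c) + complex_of_real (Im c) * \<i>) *\<^sub>C y"
        by (metis complex_eq mult.commute)
      also have "\<dots> = Re c *\<^sub>R y + Im c *\<^sub>R (\<i> *\<^sub>C y)"
        by (simp add: scaleC_add_left scaleR_eq_scaleC scaleC_scaleC)
      finally show ?thesis by (simp add: u.add u.scale)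
    qed
    have "u (\<i> *\<^sub>C (c *\<^sub>C y)) = - Im c * u y + Re c * u (\<i> *\<^sub>C y)"
      by (simp add: scaleC_scaleC e[of "\<i> * c"])
    then show ?thesis by (simp add: f_def e[of c] complex_eq_iff)
  qed
  have bound: "cmod (f y) \<le> norm y" for y
  proof (cases "f y = 0")
    case False
    define w where "w = cnj (f y) / cmod (f y)"
    have w: "cmod w = 1" using False by (simp add: w_def norm_divide)
    have "w * f y = cmod (f y)"
      using False by (simp add: w_def field_simps complex_norm_square[symmetric] power2_eq_square)
    then have "cmod (f y) = Re (f (w *\<^sub>C y))" by (simp add: scale)
    also have "\<dots> \<le> norm (w *\<^sub>C y)" by (simp add: f_def un)
    finally show ?thesis by (simp add: norm_scaleC w)
  qed simp
  have "norm x \<le> cmod (f x)" using ux complex_Re_le_cmod[of "f x"] by (simp add: f_def)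
  moreover have "f \<in> dual_ball" by (simp add: dual_ball_def add scale bound)
  ultimately show ?thesis using that by blast
qed

subsection \<open>The evaluation map into the bounded functions on the dual unit ball\<close>

definition ev :: "'a::complex_banach \<Rightarrow> (('a \<Rightarrow> complex) discrete \<Rightarrow>\<^sub>C complex)" where
  "ev x = Bcontfun (\<lambda>f. if of_discrete f \<in> dual_ball then of_discrete f x else 0)"

lemma Bcontfun_discrete_apply:
  fixes g :: "'b discrete \<Rightarrow> complex"
  assumes "\<And>f. cmod (g f) \<le> b"
  shows "apply_bcontfun (Bcontfun g) = g"
proof -
  have "continuous_on UNIV g" by (simp add: continuous_on_open_vimage open_discrete)
  then have "g \<in> bcontfun" using assms by (rule bcontfun_normI)
  then show ?thesis by (rule Bcontfun_inverse)
qed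

lemma ev_apply:
  "apply_bcontfun (ev x) = (\<lambda>f. if of_discrete f \<in> dual_ball then of_discrete f x else 0)"
  unfolding ev_def by (rule Bcontfun_discrete_apply[of _ "norm x"]) (auto simp: dual_ball_def)

lemma isometric_embedding_ev: "isometric_embedding ev"
proof -
  have norm: "norm (ev x) = norm x" for x :: 'a
  proof (rule antisym)
    show "norm (ev x) \<le> norm x"
      by (rule norm_bound) (auto simp: ev_apply dual_ball_def)
    obtain f where "f \<in> dual_ball" "norm x \<le> cmod (f x)" by (rule norming_functional)
    then show "norm x \<le> norm (ev x)"
      using norm_bounded[of "ev x" "discrete f"] by (simp add: ev_apply discrete_inverse)
  qed
  have add: "ev (x + y) = ev x + ev y" for x y :: 'a
    by (intro bcontfun_eqI) (auto simp: ev_apply dual_ball_def)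
  have scale: "ev (c *\<^sub>C x) = c *\<^sub>C ev x" for c and x :: 'a
    by (intro bcontfun_eqI)
      (auto simp: ev_apply dual_ball_def scaleC_bcontfun_apply scaleC_complex_def)
  have "bounded_linear (ev :: 'a \<Rightarrow> _)"
    by (rule bounded_linear_intro[where K = 1]) (simp_all add: add scale norm scaleR_eq_scaleC)
  then show ?thesis by (simp add: isometric_embedding_def bounded_clinear_def scale norm)
qed

lemma dual_ball_finite_partition:
  fixes \<Omega> :: "'a::complex_banach set"
  assumes "finite \<Omega>" "\<delta> > 0"
  obtains K :: "('a \<Rightarrow> complex) \<Rightarrow> ('a \<Rightarrow> complex)" where "finite (K ` dual_ball)"
    "\<And>f g x. \<lbrakk>f \<in> dual_ball; g \<in> dual_ball; K f = K g; x \<in> \<Omega>\<rbrakk> \<Longrightarrow> cmod (f x - g x) < \<delta>"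
proof -
  have "\<exists>T. finite T \<and> cball (0::complex) (norm x) \<subseteq> (\<Union>c\<in>T. ball c (\<delta> / 2))" for x :: 'a
    using conjunct2[OF compact_cball[of "0::complex" "norm x", unfolded compact_eq_totally_bounded],
        rule_format, OF half_gt_zero[OF \<open>\<delta> > 0\<close>]] .
  then obtain T where T: "finite (T x)" "cball (0::complex) (norm x) \<subseteq> (\<Union>c\<in>T x. ball c (\<delta> / 2))"
    for x :: 'a by metis
  have "\<exists>c\<in>T x. dist c (f x) < \<delta> / 2" if "f \<in> dual_ball" for f x
  proof -
    have "f x \<in> cball 0 (norm x)" using that by (simp add: dual_ball_def)
    then have "f x \<in> (\<Union>c\<in>T x. ball c (\<delta> / 2))" using T(2)[of x] by (rule rev_subsetD)
    then show ?thesis by (simp only: UN_iff mem_ball)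
  qed
  then obtain t where t: "t f x \<in> T x" "dist (t f x) (f x) < \<delta> / 2" if "f \<in> dual_ball" for f x
    by metis
  define K where "K f = restrict (t f) \<Omega>" for f
  show ?thesis
  proof
    have "K ` dual_ball \<subseteq> PiE \<Omega> T" using t(1) by (auto simp: K_def)
    then show "finite (K ` dual_ball)"
      using finite_PiE[OF assms(1), of T] T(1) by (blast intro: finite_subset)
    fix f g x assume fg: "f \<in> dual_ball" "g \<in> dual_ball" "K f = K g" "x \<in> \<Omega>"
    then have "t f x = t g x" unfolding K_def by (metis restrict_apply')
    with t(2)[OF fg(1), of x] t(2)[OF fg(2), of x]
    have "dist (f x) (g x) < \<delta>" by (metis dist_commute dist_triangle_half_l)
    then show "cmod (f x - g x) < \<delta>" by (simp add: dist_norm)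
  qed
qed

lemma le_linf_norm: "i < d \<Longrightarrow> cmod (v i) \<le> linf_norm d v"
  unfolding linf_norm_def by (intro Max_ge) auto

lemma linf_norm_le: "d > 0 \<Longrightarrow> (\<And>i. i < d \<Longrightarrow> cmod (v i) \<le> b) \<Longrightarrow> linf_norm d v \<le> b"
  unfolding linf_norm_def by (subst Max_le_iff) (auto simp: lessThan_empty_iff)

theorem CA_embedding_ev: "CA_embedding (ev :: 'a::complex_banach \<Rightarrow> _)"
  unfolding CA_embedding_def
proof (intro conjI allI impI)
  show "isometric_embedding (ev :: 'a \<Rightarrow> _)" by (rule isometric_embedding_ev)
  fix \<Omega> :: "'a set" and \<delta> :: real assume "finite \<Omega>" "\<delta> > 0"
  then obtain K :: "('a \<Rightarrow> complex) \<Rightarrow> ('a \<Rightarrow> complex)" where fin: "finite (K ` dual_ball)"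
    and K: "\<And>f g x. \<lbrakk>f \<in> dual_ball; g \<in> dual_ball; K f = K g; x \<in> \<Omega>\<rbrakk>
      \<Longrightarrow> cmod (f x - g x) < \<delta> / 2"
    using dual_ball_finite_partition[of \<Omega> "\<delta> / 2"] by auto
  define d where "d = card (K ` dual_ball)"
  obtain f0 :: "'a \<Rightarrow> complex" where "f0 \<in> dual_ball" using norming_functional by metis
  then have d: "d > 0" using fin by (auto simp: d_def card_gt_0_iff)
  obtain e where e: "bij_betw e (K ` dual_ball) {..<d}"
    using ex_bij_betw_finite_nat[OF fin] by (auto simp: d_def atLeast0LessThan)
  define idx where "idx f = e (K f)" for f
  have idx: "idx f < d" if "f \<in> dual_ball" for f
    using e that by (auto simp: idx_def bij_betw_def)
  have idx_eq: "K f = K g" if "f \<in> dual_ball" "g \<in> dual_ball" "idx f = idx g" for f g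
    using e that by (auto simp: idx_def bij_betw_def inj_on_def)
  have "\<exists>f\<in>dual_ball. idx f = i" if "i < d" for i
  proof -
    have "i \<in> e ` K ` dual_ball" using e that by (simp add: bij_betw_def)
    then show ?thesis by (auto simp: idx_def)
  qed
  then obtain r where r: "r i \<in> dual_ball" "idx (r i) = i" if "i < d" for i by metis
  have radd: "r i (x + y) = r i x + r i y" and rscale: "r i (c *\<^sub>C x) = c * r i x"
    and rnorm: "cmod (r i x) \<le> norm x" if "i < d" for i x y c
    using r(1)[OF that] by (simp_all add: dual_ball_def)
  define \<phi> where "\<phi> x = (\<lambda>i. if i < d then r i x else 0)" for x
  define \<psi> :: "(nat \<Rightarrow> complex) \<Rightarrow> (('a \<Rightarrow> complex) discrete \<Rightarrow>\<^sub>C complex)"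
    where "\<psi> v = Bcontfun (\<lambda>f. if of_discrete f \<in> dual_ball then v (idx (of_discrete f)) else 0)"
    for v
  have \<psi>: "apply_bcontfun (\<psi> v) =
      (\<lambda>f. if of_discrete f \<in> dual_ball then v (idx (of_discrete f)) else 0)" for v
    unfolding \<psi>_def
  proof (rule Bcontfun_discrete_apply[of _ "linf_norm d v"])
    fix f :: "('a \<Rightarrow> complex) discrete"
    have "0 \<le> linf_norm d v" using le_linf_norm[of 0 d v] d norm_ge_zero order_trans by blast
    then show "cmod (if of_discrete f \<in> dual_ball then v (idx (of_discrete f)) else 0) \<le> linf_norm d v"
      using le_linf_norm[OF idx] by auto
  qed
  have "contraction_to_linf d \<phi>"
    using d rnorm by (auto simp: contraction_to_linf_def linf_def \<phi>_def radd rscale intro!: linf_norm_le)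
  moreover have "contraction_from_linf d \<psi>"
    unfolding contraction_from_linf_def
  proof (intro conjI ballI allI)
    fix v :: "nat \<Rightarrow> complex"
    have "0 \<le> linf_norm d v" using le_linf_norm[of 0 d v] d norm_ge_zero order_trans by blast
    then show "norm (\<psi> v) \<le> linf_norm d v"
      using le_linf_norm[OF idx] by (intro norm_bound) (auto simp: \<psi>)
  qed (auto intro!: bcontfun_eqI simp: \<psi> scaleC_bcontfun_apply scaleC_complex_def)
  moreover have "norm (\<psi> (\<phi> x) - ev x) < \<delta>" if "x \<in> \<Omega>" for x
  proof -
    have "norm (\<psi> (\<phi> x) - ev x) \<le> \<delta> / 2"
    proof (rule norm_bound)
      fix f :: "('a \<Rightarrow> complex) discrete"
      show "norm (apply_bcontfun (\<psi> (\<phi> x) - ev x) f) \<le> \<delta> / 2"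
      proof (cases "of_discrete f \<in> dual_ball")
        case True
        let ?g = "r (idx (of_discrete f))"
        have "?g \<in> dual_ball" "idx ?g = idx (of_discrete f)" using r idx[OF True] by auto
        then have "cmod (?g x - of_discrete f x) < \<delta> / 2" using K idx_eq True that by blast
        then show ?thesis using True idx[OF True] by (simp add: \<psi> \<phi>_def ev_apply)
      qed (use \<open>\<delta> > 0\<close> in \<open>simp add: \<psi> ev_apply\<close>)
    qed
    with \<open>\<delta> > 0\<close> show ?thesis by simp
  qed
  ultimately have "(\<phi>, \<psi>, d) \<in> CA ev \<Omega> \<delta>" using d by (simp add: CA_def)
  then show "CA ev \<Omega> \<delta> \<noteq> {}" by blast
qed

end

theory Submission
  imports Defs
begin

text \<open>
  The invariant behind the theorem is the growth of covering numbers of the dual unit ball.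
  Call a finite set \<open>H\<close> of functions a \<open>\<delta>\<close>-net over \<open>\<Omega>\<close> if every functional of norm at most \<open>1\<close>
  is uniformly \<open>\<delta>\<close>-close on \<open>\<Omega>\<close> to a member of \<open>H\<close>. The main step
  (\<open>hc_eq_0_iff_subexponential_dual_nets\<close>) is that \<open>hc \<iota> \<alpha> = 0\<close> holds exactly when, for every finite
  \<open>\<Omega>\<close> and every \<open>\<delta>\<close>, the first \<open>n\<close> translates of \<open>\<Omega>\<close> admit \<open>\<delta>\<close>-nets of subexponential size in \<open>n\<close>.
  The latter condition is visibly invariant under isomorphism: pulling functionals back along
  \<open>\<gamma>\<close> distorts their norms by a bounded factor, which can be absorbed into \<open>\<delta>\<close>
  (\<open>subexponential_dual_nets_transfer\<close>). The entropy itself has no such flexibility, because the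
  maps in a factorization have to be contractions.

  One half of the main step is elementary (\<open>rc_le_card_dual_net\<close>): grouping the dual ball by a close
  net element gives a factorization of rank the size of the net.

  For the other half, take a contractive approximate factorization of rank \<open>d\<close> through
  \<open>\<ell>\<^sub>\<infinity>\<^sup>d\<close>. Extending functionals from \<open>X\<close> to the target of the CA embedding by the Hahn-Banach
  theorem, one sees that every functional in the dual ball is, on the given finite set \<open>S\<close>, close
  to an absolutely convex combination of the \<open>d\<close> coordinate functionals (\<open>CA_coefficients\<close>).
  Such a combination is approximated in mean square over \<open>S\<close> by an average of \<open>k\<close> coordinate
  functionals (up to phases), with \<open>k\<close> depending only on the accuracy and not on \<open>S\<close> or \<open>d\<close>
  (\<open>greedy_approximation\<close>, the deterministic form of Maurey's empirical method). There are only
  \<open>(4 d)\<^sup>k\<close> averages, which is subexponential if \<open>d\<close> is. A mean square estimate leaves a small proportion of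
  points of \<open>S\<close> uncontrolled. There the values are recorded on a fixed finite grid, and the number
  of ways to do this is exponential in \<open>card S\<close> with arbitrarily small rate (\<open>card_sparse_le\<close>).
  Uniform approximation by averages alone would in general require \<open>k\<close> to grow like \<open>ln (card S)\<close>,
  and then \<open>(4 d)\<^sup>k\<close> need not be subexponential.
\<close>

section \<open>Greedy approximation in absolutely convex hulls\<close>

lemma cmod_absolutely_convex_combination_le:
  assumes "T \<noteq> {}" and c: "(\<Sum>t\<in>T. cmod (c t)) \<le> 1" and b: "\<And>t. t \<in> T \<Longrightarrow> cmod (b t) \<le> R"
  shows "cmod (\<Sum>t\<in>T. c t * b t) \<le> R"
proof -
  have R: "0 \<le> R" using assms(1) b by (meson all_not_in_conv norm_ge_zero order_trans)
  have "cmod (\<Sum>t\<in>T. c t * b t) \<le> (\<Sum>t\<in>T. cmod (c t) * R)"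
    by (intro sum_norm_le) (simp add: norm_mult b mult_left_mono)
  also have "\<dots> = (\<Sum>t\<in>T. cmod (c t)) * R" by (simp add: sum_distrib_right)
  also have "\<dots> \<le> R" using c R by (simp add: mult_left_le_one_le sum_nonneg)
  finally show ?thesis .
qed

text \<open>
  Restricting to four phases keeps the dictionary of the greedy algorithm finite. The price is a
  loss in the real part, which the factor \<open>2\<close> makes up for.
\<close>

lemma exists_opposite_phase: "\<exists>z\<in>{1, \<i>, -1, -\<i>}. 2 * Re (z * w) \<le> - cmod w"
proof -
  have "cmod w \<le> \<bar>Re w\<bar> + \<bar>Im w\<bar>" by (rule cmod_le)
  then have "2 * Re w \<le> - cmod w \<or> 2 * Re (\<i> * w) \<le> - cmod w \<or> 2 * Re (- w) \<le> - cmod w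
      \<or> 2 * Re (- (\<i> * w)) \<le> - cmod w"
    by auto
  then show ?thesis by auto
qed

text \<open>
  The greedy choice. For the real inner product on functions on \<open>S\<close>, some dictionary element \<open>2 z a\<^sub>t\<close> has
  inner product with the error \<open>D\<close> no larger than that of the target \<open>g = \<Sum> c\<^sub>u a\<^sub>u\<close>: the inner product of
  \<open>D\<close> with \<open>g\<close> is at least minus the largest modulus of an inner product of \<open>D\<close> with an \<open>a\<^sub>t\<close>, and
  a suitable phase of twice the maximizing \<open>a\<^sub>t\<close> lies below this bound.
\<close>

lemma greedy_step:
  fixes a :: "'t \<Rightarrow> 's \<Rightarrow> complex"
  assumes "finite T" "T \<noteq> {}" and c: "(\<Sum>t\<in>T. cmod (c t)) \<le> 1"
  shows "\<exists>t\<in>T. \<exists>z\<in>{1, \<i>, -1, -\<i>}.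
    (\<Sum>s\<in>S. Re (cnj (D s) * (2 * z * a t s - (\<Sum>u\<in>T. c u * a u s)))) \<le> 0"
proof -
  define w where "w t = (\<Sum>s\<in>S. cnj (D s) * a t s)" for t
  define B where "B = Max ((\<lambda>t. cmod (w t)) ` T)"
  have "B \<in> (\<lambda>t. cmod (w t)) ` T" unfolding B_def using assms by (intro Max_in) auto
  then obtain t where t: "t \<in> T" "cmod (w t) = B" by auto
  have B: "cmod (w u) \<le> B" if "u \<in> T" for u
    unfolding B_def using assms that by (intro Max_ge) auto
  obtain z where z: "z \<in> {1, \<i>, -1, -\<i>}" "2 * Re (z * w t) \<le> - cmod (w t)"
    using exists_opposite_phase by metis
  have "cmod (\<Sum>u\<in>T. c u * w u) \<le> B"
    using cmod_absolutely_convex_combination_le[OF assms(2) c B] by simp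
  then have g: "- Re (\<Sum>u\<in>T. c u * w u) \<le> B"
    using abs_Re_le_cmod[of "\<Sum>u\<in>T. c u * w u"] by linarith
  have "(\<Sum>s\<in>S. cnj (D s) * (2 * z * a t s - (\<Sum>u\<in>T. c u * a u s)))
      = 2 * (z * w t) - (\<Sum>s\<in>S. \<Sum>u\<in>T. c u * (cnj (D s) * a u s))"
    by (simp add: w_def right_diff_distrib sum_subtractf sum_distrib_left mult_ac)
  also have "(\<Sum>s\<in>S. \<Sum>u\<in>T. c u * (cnj (D s) * a u s)) = (\<Sum>u\<in>T. c u * w u)"
    by (subst sum.swap) (simp add: w_def sum_distrib_left)
  finally have "(\<Sum>s\<in>S. Re (cnj (D s) * (2 * z * a t s - (\<Sum>u\<in>T. c u * a u s))))
      = 2 * Re (z * w t) - Re (\<Sum>u\<in>T. c u * w u)"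
    unfolding Re_sum[symmetric] by simp
  then show ?thesis using t z g by (intro bexI[of _ t] bexI[of _ z]) auto
qed

text \<open>
  Since every greedy increment has a nonpositive inner product with the accumulated error, the
  squared norm of the error is at most the sum of those of the increments. Each increment
  contributes at most \<open>(2R + R)\<^sup>2\<close> per point. After
  division by \<open>k\<^sup>2\<close> the mean square error of the average is thus at most \<open>9 R\<^sup>2 / k\<close>, whatever the
  sizes of \<open>S\<close> and of the dictionary.
\<close>

lemma greedy_approximation:
  fixes a :: "'t \<Rightarrow> 's \<Rightarrow> complex" and R :: real and k :: nat
  assumes T: "finite T" "T \<noteq> {}" and c: "(\<Sum>t\<in>T. cmod (c t)) \<le> 1"
    and a: "\<And>t s. t \<in> T \<Longrightarrow> s \<in> S \<Longrightarrow> cmod (a t s) \<le> R"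
  shows "\<exists>\<tau>. (\<forall>j<k. \<tau> j \<in> T \<times> {1, \<i>, -1, -\<i>}) \<and>
    (\<Sum>s\<in>S. (cmod (\<Sum>j<k. 2 * snd (\<tau> j) * a (fst (\<tau> j)) s - (\<Sum>t\<in>T. c t * a t s)))\<^sup>2)
      \<le> 9 * R\<^sup>2 * card S * k"
proof (induction k)
  case 0
  then show ?case by simp
next
  case (Suc k)
  define g where "g s = (\<Sum>t\<in>T. c t * a t s)" for s
  obtain \<tau> where \<tau>: "\<forall>j<k. \<tau> j \<in> T \<times> {1, \<i>, -1, -\<i>}" and
    IH: "(\<Sum>s\<in>S. (cmod (\<Sum>j<k. 2 * snd (\<tau> j) * a (fst (\<tau> j)) s - g s))\<^sup>2)
      \<le> 9 * R\<^sup>2 * card S * k"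
    using Suc.IH unfolding g_def by blast
  define D where "D s = (\<Sum>j<k. 2 * snd (\<tau> j) * a (fst (\<tau> j)) s - g s)" for s
  obtain t z where tz: "t \<in> T" "z \<in> {1, \<i>, -1, -\<i>}"
    and le: "(\<Sum>s\<in>S. Re (cnj (D s) * (2 * z * a t s - g s))) \<le> 0"
    using greedy_step[OF T c, where S = S and D = D and a = a] unfolding g_def by blast
  have z: "cmod z = 1" using tz(2) by auto
  define \<sigma> where "\<sigma> = \<tau>(k := (t, z))"
  have step: "(cmod (\<Sum>j<Suc k. 2 * snd (\<sigma> j) * a (fst (\<sigma> j)) s - g s))\<^sup>2
      \<le> (cmod (D s))\<^sup>2 + 2 * Re (cnj (D s) * (2 * z * a t s - g s)) + 9 * R\<^sup>2"
    if s: "s \<in> S" for s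
  proof -
    have "cmod (g s) \<le> R"
      unfolding g_def using a s by (intro cmod_absolutely_convex_combination_le T(2) c) simp
    then have "cmod (2 * z * a t s - g s) \<le> 3 * R"
      using norm_triangle_ineq4[of "2 * z * a t s" "g s"] a[OF tz(1) s] z
      by (simp add: norm_mult)
    then have sq: "(cmod (2 * z * a t s - g s))\<^sup>2 \<le> (3 * R)\<^sup>2" by (intro power_mono) auto
    have split: "(\<Sum>j<Suc k. 2 * snd (\<sigma> j) * a (fst (\<sigma> j)) s - g s)
        = D s + (2 * z * a t s - g s)"
      by (simp add: \<sigma>_def D_def)
    have "(cmod (v + w))\<^sup>2 = (cmod v)\<^sup>2 + 2 * Re (cnj v * w) + (cmod w)\<^sup>2" for v w
      by (simp add: cmod_power2) (simp add: power2_eq_square algebra_simps)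
    from this[of "D s" "2 * z * a t s - g s"] show ?thesis
      using sq unfolding split by (simp add: power_mult_distrib)
  qed
  have "(\<Sum>s\<in>S. (cmod (\<Sum>j<Suc k. 2 * snd (\<sigma> j) * a (fst (\<sigma> j)) s - g s))\<^sup>2)
      \<le> (\<Sum>s\<in>S. (cmod (D s))\<^sup>2 + 2 * Re (cnj (D s) * (2 * z * a t s - g s)) + 9 * R\<^sup>2)"
    by (intro sum_mono step)
  also have "\<dots> = (\<Sum>s\<in>S. (cmod (D s))\<^sup>2)
      + 2 * (\<Sum>s\<in>S. Re (cnj (D s) * (2 * z * a t s - g s))) + 9 * R\<^sup>2 * card S"
    by (simp add: sum.distrib sum_distrib_left)
  also have "\<dots> \<le> 9 * R\<^sup>2 * card S * Suc k"
    using IH le by (simp add: D_def algebra_simps)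
  finally show ?case
    using \<tau> tz unfolding g_def
    by (intro exI[of _ \<sigma>]) (auto simp: \<sigma>_def less_Suc_eq)
qed

section \<open>Counting nets for absolutely convex hulls\<close>

text \<open>
  An exponential moment bound: a function with at most \<open>b\<close> marked points contributes at least
  \<open>x powr b\<close> to the sum over all functions of \<open>x\<close> to the number of marked points, and that sum
  factorizes as \<open>(1 + card Q * x) ^ card S\<close>. The rate in \<open>card S\<close> is made small by choosing first \<open>x\<close> and
  then \<open>b / card S\<close> small.
\<close>

lemma card_sparse_le:
  fixes Q :: "'q set" and b x :: real
  assumes S: "finite S" and Q: "finite Q" and x: "0 < x" "x \<le> 1"
  shows "real (card {e \<in> PiE S (\<lambda>_. insert None (Some ` Q)). real (card {s \<in> S. e s \<noteq> None}) \<le> b})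
    \<le> exp (card Q * x * card S) / x powr b"
proof -
  let ?P = "PiE S (\<lambda>_. insert None (Some ` Q))"
  let ?A = "{e \<in> ?P. real (card {s \<in> S. e s \<noteq> None}) \<le> b}"
  let ?w = "\<lambda>r. if r = None then 1 else x"
  have fin: "finite ?P" using S Q by (intro finite_PiE) auto
  have w: "(\<Prod>s\<in>S. ?w (e s)) = x ^ card {s \<in> S. e s \<noteq> None}" for e :: "_ \<Rightarrow> 'q option"
    using S by (simp add: prod.If_cases Int_def)
  have "card ?A * x powr b = (\<Sum>e\<in>?A. x powr b)" by simp
  also have "\<dots> \<le> (\<Sum>e\<in>?A. \<Prod>s\<in>S. ?w (e s))"
  proof (rule sum_mono)
    fix e assume "e \<in> ?A"
    then have "x powr b \<le> x powr real (card {s \<in> S. e s \<noteq> None})"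
      using x by (intro powr_mono') auto
    then show "x powr b \<le> (\<Prod>s\<in>S. ?w (e s))" using x by (simp only: w powr_realpow)
  qed
  also have "\<dots> \<le> (\<Sum>e\<in>?P. \<Prod>s\<in>S. ?w (e s))"
    using fin x by (intro sum_mono2) (auto intro!: prod_nonneg)
  also have "\<dots> = (\<Prod>s\<in>S. \<Sum>r\<in>insert None (Some ` Q). ?w r)"
    using S Q by (intro prod_sum_PiE[symmetric]) auto
  also have "(\<Sum>r\<in>insert None (Some ` Q). ?w r) = 1 + card Q * x"
    using Q by (subst sum.insert) (auto simp: sum.reindex)
  also have "(\<Prod>s\<in>S. 1 + card Q * x) = (1 + card Q * x) ^ card S" by simp
  also have "\<dots> \<le> exp (card Q * x) ^ card S"
    using x by (intro power_mono exp_ge_add_one_self) (auto intro!: add_nonneg_nonneg)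
  also have "\<dots> = exp (card Q * x * card S)" by (simp add: exp_of_nat_mult mult.commute)
  finally show ?thesis using x by (simp add: pos_le_divide_eq)
qed

text \<open>
  A net element is coded by a dictionary average together with a sparse table of corrections:
  at the few points where the average is off by at least \<open>\<eta>\<close>, the table gives an element of the grid
  \<open>Q\<close> instead. The exponent \<open>9 R\<^sup>2 card S / (k \<eta>\<^sup>2)\<close> is Chebyshev's bound on the number of these points.
\<close>

lemma absolutely_convex_hull_net:
  fixes a :: "'t \<Rightarrow> 's \<Rightarrow> complex" and R \<eta> x :: real and k :: nat and Q :: "complex set"
  assumes T: "finite T" "T \<noteq> {}" and S: "finite S"
    and a: "\<And>t s. t \<in> T \<Longrightarrow> s \<in> S \<Longrightarrow> cmod (a t s) \<le> R"
    and Q: "finite Q" "cball 0 R \<subseteq> (\<Union>q\<in>Q. ball q \<eta>)"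
    and k: "k > 0" and \<eta>: "\<eta> > 0" and x: "0 < x" "x \<le> 1"
  obtains H where "finite H"
    "card H \<le> (4 * real (card T)) ^ k * (exp (card Q * x * card S) / x powr (9 * R\<^sup>2 * card S / (k * \<eta>\<^sup>2)))"
    "\<And>c. (\<Sum>t\<in>T. cmod (c t)) \<le> 1 \<Longrightarrow>
      \<exists>h\<in>H. \<forall>s\<in>S. cmod ((\<Sum>t\<in>T. c t * a t s) - h s) < \<eta>"
proof -
  define b where "b = 9 * R\<^sup>2 * card S / (k * \<eta>\<^sup>2)"
  define Z where "Z = {1, \<i>, -1, -\<i>}"
  have "card Z = 4" "finite Z" by (auto simp: Z_def complex_eq_iff)
  define A where "A = PiE {..<k} (\<lambda>_. T \<times> Z)"
  define E where "E = {e \<in> PiE S (\<lambda>_. insert None (Some ` Q)). real (card {s \<in> S. e s \<noteq> None}) \<le> b}"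
  define avg where "avg \<tau> s = (\<Sum>j<k. 2 * snd (\<tau> j) * a (fst (\<tau> j)) s) / k" for \<tau> s
  define dec where "dec = (\<lambda>(\<tau>, e) s. case e s of None \<Rightarrow> avg \<tau> s | Some q \<Rightarrow> q)"
  have finA: "finite A" unfolding A_def using T \<open>finite Z\<close> by (intro finite_PiE) auto
  have "finite (PiE S (\<lambda>_. insert None (Some ` Q)))" using S Q by (intro finite_PiE) auto
  then have finE: "finite E" unfolding E_def by (rule finite_subset[rotated]) auto
  have cA: "card A = (4 * card T) ^ k"
    using \<open>card Z = 4\<close> by (simp add: A_def card_PiE card_cartesian_product mult.commute)
  show ?thesis
  proof
    show "finite (dec ` (A \<times> E))" using finA finE by simp
    have "card (dec ` (A \<times> E)) \<le> card A * card E"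
      using card_image_le[of "A \<times> E" dec] finA finE by (simp add: card_cartesian_product)
    then have "real (card (dec ` (A \<times> E))) \<le> real (card A * card E)" by (rule of_nat_mono)
    also have "\<dots> \<le> (4 * real (card T)) ^ k * (exp (card Q * x * card S) / x powr b)"
      using card_sparse_le[OF S Q(1) x, of b]
      unfolding of_nat_mult of_nat_power of_nat_numeral cA E_def by (intro mult_left_mono) auto
    finally show "card (dec ` (A \<times> E))
      \<le> (4 * real (card T)) ^ k * (exp (card Q * x * card S) / x powr (9 * R\<^sup>2 * card S / (k * \<eta>\<^sup>2)))"
      by (simp add: b_def)
    fix c assume c: "(\<Sum>t\<in>T. cmod (c t)) \<le> 1"
    define g where "g s = (\<Sum>t\<in>T. c t * a t s)" for s
    have gR: "cmod (g s) \<le> R" if s: "s \<in> S" for s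
      unfolding g_def using a s by (intro cmod_absolutely_convex_combination_le T(2) c) simp
    obtain \<tau>0 where \<tau>0: "\<forall>j<k. \<tau>0 j \<in> T \<times> Z" and
      l2: "(\<Sum>s\<in>S. (cmod (\<Sum>j<k. 2 * snd (\<tau>0 j) * a (fst (\<tau>0 j)) s - g s))\<^sup>2)
        \<le> 9 * R\<^sup>2 * card S * k"
      using greedy_approximation[where a = a and S = S and R = R and k = k, OF T c a]
      unfolding g_def Z_def by blast
    \<comment> \<open>Only finitely many codes remain once the sequence is fixed outside \<open>{..<k}\<close>.\<close>
    define \<tau> where "\<tau> = restrict \<tau>0 {..<k}"
    have \<tau>: "\<tau> \<in> A" using \<tau>0 by (auto simp: A_def \<tau>_def)
    have dev: "(\<Sum>j<k. 2 * snd (\<tau>0 j) * a (fst (\<tau>0 j)) s - g s) = k * (avg \<tau> s - g s)" for s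
      using k by (simp add: avg_def \<tau>_def sum_subtractf right_diff_distrib)
    \<comment> \<open>The points that need a correction.\<close>
    define B where "B = {s \<in> S. cmod (g s - avg \<tau> s) \<ge> \<eta>}"
    have "card B * (k * \<eta>)\<^sup>2 = (\<Sum>s\<in>B. (k * \<eta>)\<^sup>2)" by simp
    also have "\<dots> \<le> (\<Sum>s\<in>B. (cmod (k * (avg \<tau> s - g s)))\<^sup>2)"
      using \<eta> by (intro sum_mono power_mono) (auto simp: B_def norm_mult norm_minus_commute intro!: mult_left_mono)
    also have "\<dots> \<le> (\<Sum>s\<in>S. (cmod (k * (avg \<tau> s - g s)))\<^sup>2)"
      using S by (intro sum_mono2) (auto simp: B_def)
    also have "\<dots> \<le> 9 * R\<^sup>2 * card S * k" using l2 by (simp only: dev)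
    finally have "card B * (k * \<eta>\<^sup>2) * k \<le> 9 * R\<^sup>2 * card S * k"
      by (simp add: power2_eq_square mult_ac)
    then have "card B * (k * \<eta>\<^sup>2) \<le> 9 * R\<^sup>2 * card S"
      by (rule mult_right_le_imp_le) (use k in simp)
    then have B: "card B \<le> b" using k \<eta> by (simp add: b_def pos_le_divide_eq)
    have "\<exists>q\<in>Q. dist q (g s) < \<eta>" if "s \<in> S" for s
    proof -
      have "g s \<in> cball 0 R" using gR[OF that] by simp
      then have "g s \<in> (\<Union>q\<in>Q. ball q \<eta>)" using Q(2) by (rule rev_subsetD)
      then show ?thesis by (simp only: UN_iff mem_ball)
    qed
    then obtain q where q: "\<And>s. s \<in> S \<Longrightarrow> q s \<in> Q"
      "\<And>s. s \<in> S \<Longrightarrow> dist (q s) (g s) < \<eta>"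
      by metis
    define e where "e = restrict (\<lambda>s. if s \<in> B then Some (q s) else None) S"
    have "{s \<in> S. e s \<noteq> None} = B" by (auto simp: e_def B_def)
    then have e: "e \<in> E" using B q(1) by (auto simp: E_def e_def)
    have "cmod (g s - dec (\<tau>, e) s) < \<eta>" if s: "s \<in> S" for s
      using q(2)[OF s] s by (auto simp: dec_def e_def B_def dist_norm norm_minus_commute)
    then show "\<exists>h\<in>dec ` (A \<times> E). \<forall>s\<in>S. cmod ((\<Sum>t\<in>T. c t * a t s) - h s) < \<eta>"
      using \<tau> e unfolding g_def by blast
  qed
qed

section \<open>Extending functionals along isometric embeddings\<close>

text \<open>
  A real functional \<open>u\<close> is the real part of exactly one complex linear functional, and rotating the
  argument until the value becomes real shows that the norm does not increase.
\<close>

lemma dual_ball_complexification: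
  fixes u :: "'a::complex_banach \<Rightarrow> real"
  assumes "linear u" and un: "\<And>y. u y \<le> norm y"
  shows "(\<lambda>y. Complex (u y) (- u (\<i> *\<^sub>C y))) \<in> dual_ball"
proof -
  interpret u: linear u by (fact assms(1))
  define f where "f y = Complex (u y) (- u (\<i> *\<^sub>C y))" for y
  have add: "f (y + z) = f y + f z" for y z
    by (simp add: f_def u.add scaleC_add_right complex_eq_iff)
  have e: "u (c *\<^sub>C y) = Re c * u y + Im c * u (\<i> *\<^sub>C y)" for c y
  proof -
    have "c *\<^sub>C y = (complex_of_real (Re c) + complex_of_real (Im c) * \<i>) *\<^sub>C y"
      by (metis complex_eq mult.commute)
    also have "\<dots> = Re c *\<^sub>R y + Im c *\<^sub>R (\<i> *\<^sub>C y)"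
      by (simp add: scaleC_add_left scaleR_eq_scaleC scaleC_scaleC)
    finally show ?thesis by (simp add: u.add u.scale)
  qed
  have scale: "f (c *\<^sub>C y) = c * f y" for c y
    by (simp add: f_def e[of c] e[of "\<i> * c"] scaleC_scaleC complex_eq_iff)
  have "cmod (f y) \<le> norm y" for y
  proof (cases "f y = 0")
    case False
    define w where "w = cnj (sgn (f y))"
    have w: "cmod w = 1" "w * f y = cmod (f y)"
      using False
      by (simp_all add: w_def norm_sgn sgn_eq norm_divide complex_norm_square[symmetric]
          power2_eq_square mult.commute)
    have "cmod (f y) = Re (f (w *\<^sub>C y))" by (simp add: scale w)
    also have "\<dots> \<le> norm (w *\<^sub>C y)" by (simp add: f_def un)
    finally show ?thesis by (simp add: norm_scaleC w)
  qed simp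
  then show ?thesis using add scale unfolding dual_ball_def f_def by blast
qed

text \<open>
  The Hahn-Banach theorem for the subspace \<open>range \<iota>\<close>. A linear functional below the sublinear
  infimal convolution \<open>p\<close> is bounded by the norm and, on \<open>range \<iota>\<close>, by the real part of \<open>f\<close>;
  the latter forces equality, as can be seen by changing signs.
\<close>

lemma dual_ball_extension:
  fixes \<iota> :: "'a::complex_banach \<Rightarrow> 'b::complex_banach"
  assumes \<iota>: "isometric_embedding \<iota>" and f: "f \<in> dual_ball"
  obtains F where "F \<in> dual_ball" "\<And>x. F (\<iota> x) = f x"
proof -
  have \<iota>lin: "linear \<iota>" and \<iota>C: "\<iota> (c *\<^sub>C x) = c *\<^sub>C \<iota> x" and \<iota>n: "norm (\<iota> x) = norm x" for c x
    using \<iota> by (auto simp: isometric_embedding_def bounded_clinear_def bounded_linear.linear)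
  interpret \<iota>: linear \<iota> by (fact \<iota>lin)
  have fadd: "f (x + y) = f x + f y" and fC: "f (c *\<^sub>C x) = c * f x" and fn: "cmod (f x) \<le> norm x"
    for x y c using f by (simp_all add: dual_ball_def)
  have fR: "Re (f (c *\<^sub>R x)) = c * Re (f x)" for c x by (simp add: scaleR_eq_scaleC fC)
  have f0: "f 0 = 0" using fadd[of 0 0] by simp
  define p where "p y = (INF x. norm (y - \<iota> x) + Re (f x))" for y
  have low: "- norm y \<le> norm (y - \<iota> x) + Re (f x)" for x y
  proof -
    have "- norm x \<le> Re (f x)" using fn[of x] abs_Re_le_cmod[of "f x"] by linarith
    moreover have "norm x \<le> norm (y - \<iota> x) + norm y"
      using norm_triangle_sub[of "\<iota> x" y] by (simp add: \<iota>n norm_minus_commute add.commute)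
    ultimately show ?thesis by linarith
  qed
  have pl: "p y \<le> norm (y - \<iota> x) + Re (f x)" for x y
    unfolding p_def by (intro cINF_lower bdd_belowI2[where m = "- norm y"] low) simp
  have pg: "m \<le> p y" if "\<And>x. m \<le> norm (y - \<iota> x) + Re (f x)" for m y
    unfolding p_def using that by (intro cINF_greatest) auto
  have "p (y + z) \<le> p y + p z" for y z
  proof -
    have "p (y + z) - (norm (z - \<iota> x') + Re (f x')) \<le> norm (y - \<iota> x) + Re (f x)" for x x'
      using pl[of "y + z" "x + x'"] norm_triangle_ineq[of "y - \<iota> x" "z - \<iota> x'"]
      by (simp add: fadd \<iota>.add algebra_simps)
    then have "p (y + z) - (norm (z - \<iota> x') + Re (f x')) \<le> p y" for x' by (rule pg)
    then have "p (y + z) - p y \<le> norm (z - \<iota> x') + Re (f x')" for x'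
      by (simp add: algebra_simps)
    then have "p (y + z) - p y \<le> p z" by (rule pg)
    then show ?thesis by simp
  qed
  moreover have hom_le: "p (c *\<^sub>R y) \<le> c * p y" if "c > 0" for c y
  proof -
    have "p (c *\<^sub>R y) / c \<le> norm (y - \<iota> x) + Re (f x)" for x
    proof -
      have "p (c *\<^sub>R y) \<le> norm (c *\<^sub>R (y - \<iota> x)) + Re (f (c *\<^sub>R x))"
        using pl[of "c *\<^sub>R y" "c *\<^sub>R x"] by (simp add: \<iota>.scale scaleR_diff_right)
      also have "\<dots> = c * (norm (y - \<iota> x) + Re (f x))"
        using that by (simp add: fR distrib_left)
      finally show ?thesis using that by (simp add: pos_divide_le_eq mult.commute)
    qed
    then have "p (c *\<^sub>R y) / c \<le> p y" by (rule pg)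
    then show ?thesis using that by (simp add: pos_divide_le_eq mult.commute)
  qed
  moreover have "c * p y \<le> p (c *\<^sub>R y)" if "c > 0" for c y
    using hom_le[of "inverse c" "c *\<^sub>R y"] that by (simp add: field_simps)
  ultimately have "sublin p" unfolding sublin_def by (metis order_antisym)
  then obtain u where u: "linear u" "u \<le> p" by (rule sublin_dominates_linear)
  interpret u: linear u by (fact u(1))
  have un: "u y \<le> norm y" for y
    using le_funD[OF u(2), of y] pl[of y 0] by (simp add: f0 \<iota>.zero)
  have ule: "u (\<iota> x) \<le> Re (f x)" for x
    using le_funD[OF u(2), of "\<iota> x"] pl[of "\<iota> x" x] by simp
  have ueq: "u (\<iota> x) = Re (f x)" for x
    using ule[of x] ule[of "- x"] fR[of "-1" x] by (simp add: \<iota>.neg u.neg)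
  have "Complex (u (\<iota> x)) (- u (\<i> *\<^sub>C \<iota> x)) = f x" for x
    by (simp add: ueq \<iota>C[symmetric] fC complex_eq_iff)
  then show ?thesis using that dual_ball_complexification[OF u(1) un] by blast
qed

section \<open>Approximation rank and nets of the dual ball\<close>

text \<open>
  The members of a net are arbitrary functions. This makes it possible to decode them pointwise
  from tables, and costs only a factor \<open>2\<close> in \<open>\<delta>\<close> when functionals are needed.
\<close>

definition dual_net :: "'a::complex_banach set \<Rightarrow> real \<Rightarrow> ('a \<Rightarrow> complex) set \<Rightarrow> bool" where
  "dual_net \<Omega> \<delta> H \<longleftrightarrow> (\<forall>f\<in>dual_ball. \<exists>h\<in>H. \<forall>x\<in>\<Omega>. cmod (f x - h x) < \<delta>)"

definition orbit_segment :: "('a \<Rightarrow> 'a) \<Rightarrow> 'a set \<Rightarrow> nat \<Rightarrow> 'a set" where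
  "orbit_segment \<alpha> \<Omega> n = (\<Union>k<n. (\<alpha> ^^ k) ` \<Omega>)"

definition subexponential_dual_nets :: "('a::complex_banach \<Rightarrow> 'a) \<Rightarrow> bool" where
  "subexponential_dual_nets \<alpha> \<longleftrightarrow> (\<forall>\<Omega> \<delta>. \<forall>\<epsilon>::real. finite \<Omega> \<longrightarrow> \<delta> > 0 \<longrightarrow> \<epsilon> > 0 \<longrightarrow>
     (\<forall>\<^sub>F n in sequentially.
       \<exists>H. finite H \<and> card H \<le> exp (\<epsilon> * n) \<and> dual_net (orbit_segment \<alpha> \<Omega> n) \<delta> H))"

lemma zero_in_dual_ball: "(\<lambda>_. 0) \<in> dual_ball"
  by (simp add: dual_ball_def)

lemma linf_coordinate_in_dual_ball:
  assumes "contraction_to_linf d \<phi>" "i < d"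
  shows "(\<lambda>x. \<phi> x i) \<in> dual_ball"
  using assms order_trans[OF le_linf_norm[OF assms(2)]]
  by (auto simp: contraction_to_linf_def dual_ball_def)

text \<open>
  Choose one functional \<open>r\<^sub>i\<close> for each net element and let \<open>\<phi>\<close> evaluate at these. A factorization
  \<open>\<psi>0 \<circ> \<phi>0\<close> of \<open>\<iota>\<close> of some uncontrolled rank \<open>d0\<close> exists because \<open>\<iota>\<close> is a CA embedding. Its
  coordinate functionals lie in the dual ball, so each is close on \<open>\<Omega>\<close> to the \<open>r\<^sub>i\<close> with the same net
  element, and on \<open>\<Omega>\<close> the map \<open>\<phi>0\<close> is recovered from \<open>\<phi>\<close> up to \<open>2 \<delta>\<close> by the contraction \<open>\<rho>\<close> that copies
  coordinates. This passage through \<open>\<rho>\<close> replaces an extension property of the target of \<open>\<iota>\<close>, which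
  is an arbitrary Banach space.
\<close>

lemma rc_le_card_dual_net:
  fixes \<iota> :: "'a::complex_banach \<Rightarrow> 'b::complex_banach"
  assumes \<iota>: "CA_embedding \<iota>" and \<Omega>: "finite \<Omega>" and \<delta>: "\<delta> > 0"
    and H: "finite H" "dual_net \<Omega> \<delta> H"
  shows "rc \<iota> \<Omega> (3 * \<delta>) \<le> card H"
proof -
  obtain \<phi>0 \<psi>0 d0 where d0: "d0 > 0" and \<phi>0: "contraction_to_linf d0 \<phi>0"
    and \<psi>0: "contraction_from_linf d0 \<psi>0"
    and approx: "\<And>x. x \<in> \<Omega> \<Longrightarrow> norm (\<psi>0 (\<phi>0 x) - \<iota> x) < \<delta>"
  proof -
    have "CA \<iota> \<Omega> \<delta> \<noteq> {}" using \<iota> \<Omega> \<delta> by (simp add: CA_embedding_def)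
    then show ?thesis using that by (auto simp: CA_def)
  qed
  define d where "d = card H"
  obtain e where e: "bij_betw e H {..<d}"
    using ex_bij_betw_finite_nat[OF H(1)] by (auto simp: d_def atLeast0LessThan)
  obtain \<kappa> where \<kappa>: "\<And>f. f \<in> dual_ball \<Longrightarrow> \<kappa> f \<in> H"
    "\<And>f x. f \<in> dual_ball \<Longrightarrow> x \<in> \<Omega> \<Longrightarrow> cmod (f x - \<kappa> f x) < \<delta>"
    using H(2) unfolding dual_net_def by metis
  have d: "d > 0" using \<kappa>(1)[OF zero_in_dual_ball] H(1) by (auto simp: d_def card_gt_0_iff)
  define idx where "idx f = e (\<kappa> f)" for f
  have idx: "idx f < d" if "f \<in> dual_ball" for f
    using bij_betwE[OF e] \<kappa>(1)[OF that] by (auto simp: idx_def)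
  have close: "cmod (f x - g x) < 2 * \<delta>"
    if "f \<in> dual_ball" "g \<in> dual_ball" "idx f = idx g" "x \<in> \<Omega>" for f g x
  proof -
    have "\<kappa> f = \<kappa> g"
      using inj_onD[OF bij_betw_imp_inj_on[OF e]] that(3) \<kappa>(1) that(1,2)
      unfolding idx_def by blast
    then show ?thesis
      using \<kappa>(2)[OF that(1,4)] \<kappa>(2)[OF that(2,4)]
        norm_triangle_ineq4[of "f x - \<kappa> f x" "g x - \<kappa> f x"] by simp
  qed
  \<comment> \<open>Indices of net elements that \<open>\<kappa>\<close> assigns to no functional are represented by zero.\<close>
  have "\<exists>r\<in>dual_ball. \<forall>f\<in>dual_ball. idx f = i \<longrightarrow> idx r = i" for i
    using zero_in_dual_ball by blast
  then have "\<forall>i. \<exists>r. r \<in> dual_ball \<and> (\<forall>f\<in>dual_ball. idx f = i \<longrightarrow> idx r = i)" by blast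
  from choice[OF this] obtain r where r: "\<And>i. r i \<in> dual_ball"
    and r_idx: "\<And>f. f \<in> dual_ball \<Longrightarrow> idx (r (idx f)) = idx f" by blast
  have radd: "r i (x + y) = r i x + r i y" and rscale: "r i (c *\<^sub>C x) = c * r i x"
    and rnorm: "cmod (r i x) \<le> norm x" for i x y c
    using r[of i] by (simp_all add: dual_ball_def)
  define \<phi> where "\<phi> x = (\<lambda>i. if i < d then r i x else 0)" for x
  define \<rho> :: "(nat \<Rightarrow> complex) \<Rightarrow> nat \<Rightarrow> complex"
    where "\<rho> v = (\<lambda>j. if j < d0 then v (idx (\<lambda>x. \<phi>0 x j)) else 0)" for v
  have coord: "(\<lambda>x. \<phi>0 x j) \<in> dual_ball" if "j < d0" for j
    using linf_coordinate_in_dual_ball[OF \<phi>0 that] .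
  have \<rho>: "\<rho> v \<in> linf d0" "linf_norm d0 (\<rho> v) \<le> linf_norm d v" for v
  proof -
    show "\<rho> v \<in> linf d0" by (simp add: \<rho>_def linf_def)
    show "linf_norm d0 (\<rho> v) \<le> linf_norm d v"
    proof (rule linf_norm_le[OF d0])
      show "cmod (\<rho> v j) \<le> linf_norm d v" if "j < d0" for j
        using le_linf_norm[OF idx[OF coord[OF that]], of v] that by (simp add: \<rho>_def)
    qed
  qed
  have "contraction_to_linf d \<phi>"
    using d rnorm
    by (auto simp: contraction_to_linf_def linf_def \<phi>_def radd rscale intro!: linf_norm_le)
  moreover have "contraction_from_linf d (\<lambda>v. \<psi>0 (\<rho> v))"
  proof -
    have "\<rho> (\<lambda>i. v i + w i) = (\<lambda>i. \<rho> v i + \<rho> w i)" "\<rho> (\<lambda>i. c * v i) = (\<lambda>i. c * \<rho> v i)" for v w c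
      by (auto simp: \<rho>_def)
    then show ?thesis
      using \<psi>0 \<rho>(1) order_trans[OF _ \<rho>(2)] unfolding contraction_from_linf_def by simp
  qed
  moreover have "norm (\<psi>0 (\<rho> (\<phi> x)) - \<iota> x) < 3 * \<delta>" if x: "x \<in> \<Omega>" for x
  proof -
    have sub: "\<psi>0 (\<lambda>i. v i + (-1) * w i) = \<psi>0 v - \<psi>0 w" if "v \<in> linf d0" "w \<in> linf d0" for v w
    proof -
      have "\<psi>0 (\<lambda>i. v i + (-1) * w i) = \<psi>0 v + \<psi>0 (\<lambda>i. (-1) * w i)"
      proof -
        have "(\<lambda>i. (-1) * w i) \<in> linf d0" using that(2) by (simp add: linf_def)
        with \<psi>0 that(1) show ?thesis unfolding contraction_from_linf_def by metis
      qed
      also have "\<psi>0 (\<lambda>i. (-1) * w i) = (-1) *\<^sub>C \<psi>0 w"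
        using \<psi>0 that unfolding contraction_from_linf_def by blast
      also have "(-1) *\<^sub>C \<psi>0 w = - \<psi>0 w" using scaleR_eq_scaleC[of "-1" "\<psi>0 w"] by simp
      finally show ?thesis by simp
    qed
    have in_linf: "\<phi>0 x \<in> linf d0" using \<phi>0 by (simp add: contraction_to_linf_def)
    have "norm (\<psi>0 (\<rho> (\<phi> x)) - \<psi>0 (\<phi>0 x)) = norm (\<psi>0 (\<lambda>i. \<rho> (\<phi> x) i + (-1) * \<phi>0 x i))"
      using sub[OF \<rho>(1) in_linf] by simp
    also have "\<dots> \<le> linf_norm d0 (\<lambda>i. \<rho> (\<phi> x) i + (-1) * \<phi>0 x i)"
    proof -
      have "(\<lambda>i. \<rho> (\<phi> x) i + (-1) * \<phi>0 x i) \<in> linf d0"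
        using \<rho>(1) in_linf by (auto simp: linf_def)
      then show ?thesis using \<psi>0 unfolding contraction_from_linf_def by blast
    qed
    also have "\<dots> \<le> 2 * \<delta>"
    proof (rule linf_norm_le[OF d0])
      fix j assume j: "j < d0"
      have "cmod (r (idx (\<lambda>x. \<phi>0 x j)) x - \<phi>0 x j) < 2 * \<delta>"
        using close[OF r coord[OF j] r_idx[OF coord[OF j]] x] .
      then show "cmod (\<rho> (\<phi> x) j + (-1) * \<phi>0 x j) \<le> 2 * \<delta>"
        using j idx[OF coord[OF j]] by (simp add: \<rho>_def \<phi>_def)
    qed
    finally have "norm (\<psi>0 (\<rho> (\<phi> x)) - \<psi>0 (\<phi>0 x)) \<le> 2 * \<delta>" .
    then show ?thesis
      using approx[OF x]
        norm_triangle_ineq[of "\<psi>0 (\<rho> (\<phi> x)) - \<psi>0 (\<phi>0 x)" "\<psi>0 (\<phi>0 x) - \<iota> x"] by simp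
  qed
  ultimately have "(\<phi>, \<lambda>v. \<psi>0 (\<rho> v), d) \<in> CA \<iota> \<Omega> (3 * \<delta>)" using d by (simp add: CA_def)
  then show ?thesis unfolding rc_def d_def by (intro cInf_lower) auto
qed

text \<open>
  Extend \<open>f\<close> to a functional \<open>F\<close> with \<open>F \<circ> \<iota> = f\<close>. Then \<open>f\<close> is close to \<open>F \<circ> \<psi> \<circ> \<phi>\<close>, and \<open>F \<circ> \<psi>\<close> is a
  contractive functional on \<open>\<ell>\<^sub>\<infinity>\<^sup>d\<close>, hence given by a vector in the unit ball of \<open>\<ell>\<^sub>1\<^sup>d\<close>.
\<close>

lemma CA_coefficients:
  fixes \<iota> :: "'a::complex_banach \<Rightarrow> 'b::complex_banach"
  assumes \<iota>: "isometric_embedding \<iota>" and CA: "(\<phi>, \<psi>, d) \<in> CA \<iota> \<Omega> \<eta>" and f: "f \<in> dual_ball"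
  obtains c where "(\<Sum>i<d. cmod (c i)) \<le> 1"
    "\<And>x. x \<in> \<Omega> \<Longrightarrow> cmod (f x - (\<Sum>i<d. c i * \<phi> x i)) < \<eta>"
proof -
  have d: "d > 0" and \<phi>: "contraction_to_linf d \<phi>" and \<psi>: "contraction_from_linf d \<psi>"
    and approx: "\<And>x. x \<in> \<Omega> \<Longrightarrow> norm (\<psi> (\<phi> x) - \<iota> x) < \<eta>"
    using CA by (simp_all add: CA_def)
  obtain F where F: "F \<in> dual_ball" "\<And>x. F (\<iota> x) = f x"
    using dual_ball_extension[OF \<iota> f] by blast
  have Fadd: "F (x + y) = F x + F y" and FC: "F (c *\<^sub>C x) = c * F x" and Fn: "cmod (F x) \<le> norm x"
    for x y c using F(1) by (simp_all add: dual_ball_def)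
  define c where "c i = F (\<psi> (\<lambda>j. if j = i then 1 else 0))" for i :: nat
  have \<psi>add: "\<psi> (\<lambda>i. v i + w i) = \<psi> v + \<psi> w" if "v \<in> linf d" "w \<in> linf d" for v w
    using \<psi> that unfolding contraction_from_linf_def by blast
  have \<psi>scale: "\<psi> (\<lambda>i. b * v i) = b *\<^sub>C \<psi> v" if "v \<in> linf d" for v b
    using \<psi> that unfolding contraction_from_linf_def by blast
  have partial: "F (\<psi> (\<lambda>i. if i < m then v i else 0)) = (\<Sum>i<m. c i * v i)" if "m \<le> d" for m v
    using that
  proof (induction m)
    case 0
    have "\<psi> (\<lambda>_. 0) = 0 *\<^sub>C \<psi> (\<lambda>_. 0)" using \<psi>scale[of "\<lambda>_. 0" 0] by (simp add: linf_def)
    then have "F (\<psi> (\<lambda>_. 0)) = 0" by (metis FC mult_zero_left)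
    then show ?case by simp
  next
    case (Suc m)
    have "(\<lambda>i. if i < Suc m then v i else 0)
        = (\<lambda>i. (if i < m then v i else 0) + v m * (if i = m then 1 else 0))"
      by (auto simp: fun_eq_iff less_Suc_eq)
    then have "F (\<psi> (\<lambda>i. if i < Suc m then v i else 0))
        = F (\<psi> (\<lambda>i. (if i < m then v i else 0) + v m * (if i = m then 1 else 0)))"
      by (rule arg_cong)
    also have "\<dots> = F (\<psi> (\<lambda>i. if i < m then v i else 0)) + v m * c m"
      using Suc.prems
      by (subst \<psi>add, simp_all add: linf_def)
        (subst \<psi>scale, simp_all add: linf_def Fadd FC c_def)
    finally show ?case using Suc by simp
  qed
  have expand: "F (\<psi> v) = (\<Sum>i<d. c i * v i)" if "v \<in> linf d" for v
  proof -
    have "(\<lambda>i. if i < d then v i else 0) = v" using that by (auto simp: linf_def fun_eq_iff)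
    then show ?thesis using partial[of d v] by simp
  qed
  show ?thesis
  proof
    \<comment> \<open>The sign vector at which \<open>F \<circ> \<psi>\<close> attains the sum of the moduli of its coefficients.\<close>
    define v where "v i = (if i < d then cnj (sgn (c i)) else 0)" for i
    have v: "v \<in> linf d" by (simp add: v_def linf_def)
    have "linf_norm d v \<le> 1" using d by (intro linf_norm_le) (auto simp: v_def norm_sgn)
    then have "norm (\<psi> v) \<le> 1" using \<psi> v unfolding contraction_from_linf_def by fastforce
    have "c i * cnj (sgn (c i)) = cmod (c i)" for i
      by (cases "c i = 0") (simp_all add: sgn_eq complex_norm_square[symmetric] power2_eq_square)
    then have "complex_of_real (\<Sum>i<d. cmod (c i)) = F (\<psi> v)"
      unfolding expand[OF v] by (simp add: v_def)
    then have "Re (F (\<psi> v)) = (\<Sum>i<d. cmod (c i))" by (metis Re_complex_of_real)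
    then show "(\<Sum>i<d. cmod (c i)) \<le> 1" 
      using Fn[of "\<psi> v"] complex_Re_le_cmod[of "F (\<psi> v)"] \<open>norm (\<psi> v) \<le> 1\<close> by linarith
    fix x assume x: "x \<in> \<Omega>"
    have "F (- y) = - F y" for y
      using FC[of "-1" y] scaleR_eq_scaleC[of "-1" y] by simp
    then have "F (\<psi> (\<phi> x) - \<iota> x) = (\<Sum>i<d. c i * \<phi> x i) - f x"
      using Fadd[of "\<psi> (\<phi> x)" "- \<iota> x"] F(2) expand[of "\<phi> x"] \<phi>
      by (simp add: contraction_to_linf_def)
    then show "cmod (f x - (\<Sum>i<d. c i * \<phi> x i)) < \<eta>"
      using approx[OF x] Fn[of "\<psi> (\<phi> x) - \<iota> x"] by (simp add: norm_minus_commute)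
  qed
qed

lemma CA_dual_net:
  fixes \<iota> :: "'a::complex_banach \<Rightarrow> 'b::complex_banach" and R \<eta> x :: real and k :: nat
    and Q :: "complex set"
  assumes \<iota>: "isometric_embedding \<iota>" and CA: "(\<phi>, \<psi>, d) \<in> CA \<iota> S \<eta>" and S: "finite S"
    and R: "\<And>s. s \<in> S \<Longrightarrow> norm s \<le> R"
    and Q: "finite Q" "cball 0 R \<subseteq> (\<Union>q\<in>Q. ball q \<eta>)"
    and k: "k > 0" and \<eta>: "\<eta> > 0" and x: "0 < x" "x \<le> 1"
  obtains H where "finite H" "dual_net S (2 * \<eta>) H"
    "card H \<le> (4 * real d) ^ k * (exp (card Q * x * card S) / x powr (9 * R\<^sup>2 * card S / (k * \<eta>\<^sup>2)))"
proof -
  have d: "d > 0" and \<phi>: "contraction_to_linf d \<phi>" using CA by (auto simp: CA_def)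
  have a: "cmod (\<phi> s i) \<le> R" if "i \<in> {..<d}" "s \<in> S" for i s
    using linf_coordinate_in_dual_ball[OF \<phi>, of i] that R[OF that(2)]
    by (auto simp: dual_ball_def intro: order_trans)
  have ne: "{..<d} \<noteq> {}" using d by auto
  obtain H where H: "finite H"
    "card H \<le> (4 * real (card {..<d})) ^ k
      * (exp (card Q * x * card S) / x powr (9 * R\<^sup>2 * card S / (k * \<eta>\<^sup>2)))"
    "\<And>c. (\<Sum>i<d. cmod (c i)) \<le> 1 \<Longrightarrow>
      \<exists>h\<in>H. \<forall>s\<in>S. cmod ((\<Sum>i<d. c i * \<phi> s i) - h s) < \<eta>"
    using absolutely_convex_hull_net[where T = "{..<d}" and a = "\<lambda>i s. \<phi> s i" and S = S and R = R,
        OF finite_lessThan ne S a Q k \<eta> x] by blast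
  have "dual_net S (2 * \<eta>) H"
    unfolding dual_net_def
  proof
    fix f :: "'a \<Rightarrow> complex" assume "f \<in> dual_ball"
    then obtain c where c: "(\<Sum>i<d. cmod (c i)) \<le> 1"
      "\<And>s. s \<in> S \<Longrightarrow> cmod (f s - (\<Sum>i<d. c i * \<phi> s i)) < \<eta>"
      using CA_coefficients[OF \<iota> CA] by metis
    obtain h where h: "h \<in> H" "\<And>s. s \<in> S \<Longrightarrow> cmod ((\<Sum>i<d. c i * \<phi> s i) - h s) < \<eta>"
      using H(3)[OF c(1)] by blast
    have "cmod (f s - h s) < 2 * \<eta>" if "s \<in> S" for s
      using c(2)[OF that] h(2)[OF that]
        norm_triangle_ineq[of "f s - (\<Sum>i<d. c i * \<phi> s i)" "(\<Sum>i<d. c i * \<phi> s i) - h s"]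
      by simp
    then show "\<exists>h\<in>H. \<forall>s\<in>S. cmod (f s - h s) < 2 * \<eta>" using h(1) by blast
  qed
  then show ?thesis using that H(1,2) by simp
qed

section \<open>Zero entropy as subexponential growth\<close>

lemma finite_orbit_segment: "finite \<Omega> \<Longrightarrow> finite (orbit_segment \<alpha> \<Omega> n)"
  by (simp add: orbit_segment_def)

lemma card_orbit_segment_le: "finite \<Omega> \<Longrightarrow> card (orbit_segment \<alpha> \<Omega> n) \<le> n * card \<Omega>"
proof -
  assume "finite \<Omega>"
  have "card (orbit_segment \<alpha> \<Omega> n) \<le> (\<Sum>k<n. card ((\<alpha> ^^ k) ` \<Omega>))"
    unfolding orbit_segment_def by (intro card_UN_le) simp
  also have "\<dots> \<le> (\<Sum>k<n. card \<Omega>)" using \<open>finite \<Omega>\<close> by (intro sum_mono card_image_le)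
  finally show ?thesis by simp
qed

lemma norm_orbit_segment:
  assumes "isometric_automorphism \<alpha>" "\<And>x. x \<in> \<Omega> \<Longrightarrow> norm x \<le> R" "y \<in> orbit_segment \<alpha> \<Omega> n"
  shows "norm y \<le> R"
proof -
  have "norm ((\<alpha> ^^ k) x) = norm x" for k x
    using assms(1)
    by (induction k) (simp_all add: isometric_automorphism_def isometric_embedding_def)
  then show ?thesis using assms(2,3) by (auto simp: orbit_segment_def)
qed

lemma CA_rc:
  assumes "CA_embedding \<iota>" "finite \<Omega>" "\<delta> > 0"
  obtains \<phi> \<psi> where "(\<phi>, \<psi>, rc \<iota> \<Omega> \<delta>) \<in> CA \<iota> \<Omega> \<delta>"
proof -
  have "{d. \<exists>\<phi> \<psi>. (\<phi>, \<psi>, d) \<in> CA \<iota> \<Omega> \<delta>} \<noteq> {}"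
    using assms unfolding CA_embedding_def by fast
  then have "rc \<iota> \<Omega> \<delta> \<in> {d. \<exists>\<phi> \<psi>. (\<phi>, \<psi>, d) \<in> CA \<iota> \<Omega> \<delta>}"
    unfolding rc_def by (rule Inf_nat_def1)
  then show ?thesis using that by blast
qed

lemma rc_pos:
  assumes "CA_embedding \<iota>" "finite \<Omega>" "\<delta> > 0"
  shows "rc \<iota> \<Omega> \<delta> > 0"
  using CA_rc[OF assms] by (auto simp: CA_def)

lemma hc_eq_0_iff:
  fixes \<iota> :: "'a::complex_banach \<Rightarrow> 'b::complex_banach"
  assumes \<iota>: "CA_embedding \<iota>"
  shows "hc \<iota> \<alpha> = 0 \<longleftrightarrow> (\<forall>\<Omega> \<delta>. \<forall>\<epsilon>::real. finite \<Omega> \<longrightarrow> \<delta> > 0 \<longrightarrow> \<epsilon> > 0 \<longrightarrow>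
    (\<forall>\<^sub>F n in sequentially. rc \<iota> (orbit_segment \<alpha> \<Omega> n) \<delta> \<le> exp (\<epsilon> * n)))"
proof -
  define r where "r \<Omega> \<delta> n = rc \<iota> (orbit_segment \<alpha> \<Omega> n) \<delta>" for \<Omega> \<delta> n
  have pos: "r \<Omega> \<delta> n > 0" if "finite \<Omega>" "\<delta> > 0" for \<Omega> \<delta> n
    unfolding r_def using rc_pos[OF \<iota> finite_orbit_segment] that by blast
  have hcd: "hc_delta \<iota> \<alpha> \<Omega> \<delta> = limsup (\<lambda>n. ereal (ln (r \<Omega> \<delta> n) / n))" for \<Omega> \<delta>
    by (simp add: hc_delta_def r_def orbit_segment_def)
  have nonneg: "0 \<le> hc_delta \<iota> \<alpha> \<Omega> \<delta>" if "finite \<Omega>" "\<delta> > 0" for \<Omega> \<delta>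
  proof -
    have "0 \<le> ereal (ln (r \<Omega> \<delta> n) / n)" for n
      using pos[OF that, of n] by simp
    then show ?thesis unfolding hcd by (intro le_Limsup) (simp_all add: always_eventually)
  qed
  have "hc \<iota> \<alpha> \<ge> hc_delta \<iota> \<alpha> {} 1"
    unfolding hc_def hc_set_def by (intro SUP_upper2[where i = "{}"] SUP_upper2[where i = 1]) auto
  then have "hc \<iota> \<alpha> \<ge> 0" using nonneg[of "{}" 1] by (auto intro: order_trans)
  then have "hc \<iota> \<alpha> = 0 \<longleftrightarrow> hc \<iota> \<alpha> \<le> 0" by auto
  also have "\<dots> \<longleftrightarrow> (\<forall>\<Omega> \<delta>. finite \<Omega> \<longrightarrow> \<delta> > 0 \<longrightarrow> hc_delta \<iota> \<alpha> \<Omega> \<delta> \<le> 0)"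
    unfolding hc_def hc_set_def by (auto simp: SUP_le_iff)
  also have "\<dots> \<longleftrightarrow> (\<forall>\<Omega> \<delta>. finite \<Omega> \<longrightarrow> \<delta> > 0 \<longrightarrow>
      (\<forall>\<epsilon>::real. \<epsilon> > 0 \<longrightarrow> (\<forall>\<^sub>F n in sequentially. r \<Omega> \<delta> n \<le> exp (\<epsilon> * n))))"
  proof -
    have "hc_delta \<iota> \<alpha> \<Omega> \<delta> \<le> 0
        \<longleftrightarrow> (\<forall>\<epsilon>::real. \<epsilon> > 0 \<longrightarrow> (\<forall>\<^sub>F n in sequentially. r \<Omega> \<delta> n \<le> exp (\<epsilon> * n)))"
      if "finite \<Omega>" "\<delta> > 0" for \<Omega> \<delta>
    proof -
      have iff: "ln (r \<Omega> \<delta> n) / n \<le> \<epsilon> \<longleftrightarrow> r \<Omega> \<delta> n \<le> exp (\<epsilon> * n)" if "n > 0" for n \<epsilon>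
        using that pos[OF \<open>finite \<Omega>\<close> \<open>\<delta> > 0\<close>, of n]
        by (simp add: pos_divide_le_eq) (metis exp_le_cancel_iff exp_ln of_nat_0_less_iff)
      show ?thesis
      proof (intro iffI allI impI)
        fix \<epsilon> :: real assume "hc_delta \<iota> \<alpha> \<Omega> \<delta> \<le> 0" "\<epsilon> > 0"
        then have "limsup (\<lambda>n. ereal (ln (r \<Omega> \<delta> n) / n)) < ereal \<epsilon>"
          unfolding hcd by (metis ereal_less(2) order_le_less_trans)
        then have "\<forall>\<^sub>F n in sequentially. ereal (ln (r \<Omega> \<delta> n) / n) < ereal \<epsilon>"
          by (rule Limsup_lessD)
        then show "\<forall>\<^sub>F n in sequentially. r \<Omega> \<delta> n \<le> exp (\<epsilon> * n)"
          using eventually_gt_at_top[of 0]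
        proof eventually_elim
          case (elim n)
          then show ?case using iff[of n \<epsilon>] by simp
        qed
      next
        assume *: "\<forall>\<epsilon>::real. \<epsilon> > 0 \<longrightarrow> (\<forall>\<^sub>F n in sequentially. r \<Omega> \<delta> n \<le> exp (\<epsilon> * n))"
        have "hc_delta \<iota> \<alpha> \<Omega> \<delta> \<le> 0 + ereal \<epsilon>" if "\<epsilon> > 0" for \<epsilon>
        proof -
          have "\<forall>\<^sub>F n in sequentially. ereal (ln (r \<Omega> \<delta> n) / n) \<le> ereal \<epsilon>"
            using *[rule_format, OF that] eventually_gt_at_top[of 0]
          proof eventually_elim
            case (elim n)
            then show ?case using iff[of n \<epsilon>] by simp
          qed
          then have "limsup (\<lambda>n. ereal (ln (r \<Omega> \<delta> n) / n)) \<le> ereal \<epsilon>" by (rule Limsup_bounded)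
          then show ?thesis unfolding hcd add_0_left .
        qed
        then show "hc_delta \<iota> \<alpha> \<Omega> \<delta> \<le> 0" by (rule ereal_le_epsilon2)
      qed
    qed
    then show ?thesis by (simp cong: imp_cong)
  qed
  finally show ?thesis unfolding r_def by auto
qed

text \<open>
  In the direction from zero entropy to nets, the parameters are fixed in the order \<open>x\<close>, \<open>\<theta>\<close>, \<open>k\<close>:
  the grid \<open>Q\<close> determines \<open>x\<close>, then \<open>\<theta>\<close> bounds the admissible proportion of corrected points, and \<open>k\<close>
  makes Chebyshev's bound at most \<open>\<theta>\<close>. None of them depends on \<open>n\<close>, so the rank enters only through its
  \<open>k\<close>-th power, and it suffices to invoke zero entropy with rate \<open>\<epsilon> / (4 k)\<close>. The four contributions
  to the logarithm of the size of the net (the phases, the rank, the grid, and the sparsity) are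
  each at most \<open>\<epsilon> n / 4\<close>.
\<close>

theorem hc_eq_0_iff_subexponential_dual_nets:
  fixes \<iota> :: "'a::complex_banach \<Rightarrow> 'b::complex_banach"
  assumes \<iota>: "CA_embedding \<iota>" and \<alpha>: "isometric_automorphism \<alpha>"
  shows "hc \<iota> \<alpha> = 0 \<longleftrightarrow> subexponential_dual_nets \<alpha>"
proof
  assume nets: "subexponential_dual_nets \<alpha>"
  show "hc \<iota> \<alpha> = 0"
    unfolding hc_eq_0_iff[OF \<iota>]
  proof (intro allI impI)
    fix \<Omega> :: "'a set" and \<delta> \<epsilon> :: real assume *: "finite \<Omega>" "\<delta> > 0" "\<epsilon> > 0"
    then have "\<forall>\<^sub>F n in sequentially. \<exists>H. finite H \<and> card H \<le> exp (\<epsilon> * n)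
        \<and> dual_net (orbit_segment \<alpha> \<Omega> n) (\<delta> / 3) H"
      using nets[unfolded subexponential_dual_nets_def, rule_format, of \<Omega> "\<delta> / 3" \<epsilon>] by simp
    then show "\<forall>\<^sub>F n in sequentially. rc \<iota> (orbit_segment \<alpha> \<Omega> n) \<delta> \<le> exp (\<epsilon> * n)"
    proof eventually_elim
      case (elim n)
      then obtain H where "finite H" "card H \<le> exp (\<epsilon> * n)"
        "dual_net (orbit_segment \<alpha> \<Omega> n) (\<delta> / 3) H" by blast
      then show ?case
        using rc_le_card_dual_net[OF \<iota> finite_orbit_segment[OF *(1)], of "\<delta> / 3" H \<alpha> n] *(2)
        by simp
    qed
  qed
next
  assume "hc \<iota> \<alpha> = 0"
  then have rc: "\<forall>\<^sub>F n in sequentially. rc \<iota> (orbit_segment \<alpha> \<Omega> n) \<delta> \<le> exp (\<epsilon> * n)"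
    if "finite \<Omega>" "\<delta> > 0" "\<epsilon> > 0" for \<Omega> \<delta> and \<epsilon> :: real
    using that hc_eq_0_iff[OF \<iota>, of \<alpha>] by simp
  show "subexponential_dual_nets \<alpha>"
    unfolding subexponential_dual_nets_def
  proof (intro allI impI)
    fix \<Omega> :: "'a set" and \<delta> \<epsilon> :: real assume \<Omega>: "finite \<Omega>" and \<delta>: "\<delta> > 0" and \<epsilon>: "\<epsilon> > 0"
    define \<eta> where "\<eta> = \<delta> / 2"
    have \<eta>: "\<eta> > 0" using \<delta> by (simp add: \<eta>_def)
    obtain R where R: "\<And>x. x \<in> \<Omega> \<Longrightarrow> norm x \<le> R"
      using finite_imp_bounded[OF \<Omega>] unfolding bounded_iff by blast
    obtain Q where Q: "finite Q" "cball (0::complex) R \<subseteq> (\<Union>q\<in>Q. ball q \<eta>)"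
      using conjunct2[OF compact_cball[of "0::complex" R, unfolded compact_eq_totally_bounded],
        rule_format, OF \<eta>] by blast
    \<comment> \<open>The additional \<open>1\<close> keeps \<open>M\<close> positive when \<open>\<Omega>\<close> is empty.\<close>
    define M where "M = real (card \<Omega>) + 1"
    have M: "M > 0" by (simp add: M_def add_nonneg_pos)
    define x where "x = min 1 (\<epsilon> / (4 * M * (card Q + 1)))"
    have x: "0 < x" "x \<le> 1" using \<epsilon> M by (auto simp: x_def)
    have xQ: "card Q * x * M \<le> \<epsilon> / 4"
    proof -
      have "card Q * x * M \<le> (card Q + 1) * (\<epsilon> / (4 * M * (card Q + 1))) * M"
        using x M \<epsilon> by (intro mult_mono) (auto simp: x_def)
      also have "\<dots> = \<epsilon> / 4" using M by (simp add: field_simps del: of_nat_Suc of_nat_add)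
      finally show ?thesis .
    qed
    have lnx: "ln x \<le> 0" using x by simp
    define \<theta> where "\<theta> = \<epsilon> / (4 * M * (1 - ln x))"
    have \<theta>: "\<theta> > 0" using \<epsilon> M lnx by (simp add: \<theta>_def)
    have \<theta>x: "\<theta> * M * (- ln x) \<le> \<epsilon> / 4"
    proof -
      have "\<theta> * M * (- ln x) \<le> \<theta> * M * (1 - ln x)" using \<theta> M by (intro mult_left_mono) auto
      also have "\<dots> = \<epsilon> / 4" using M lnx by (simp add: \<theta>_def field_simps)
      finally show ?thesis .
    qed
    obtain k0 :: nat where k0: "9 * R\<^sup>2 / (\<theta> * \<eta>\<^sup>2) \<le> k0" using real_arch_simple by blast
    define k where "k = Suc k0"
    have k: "k > 0" by (simp add: k_def)
    have k\<theta>: "9 * R\<^sup>2 / (k * \<eta>\<^sup>2) \<le> \<theta>"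
    proof -
      have "9 * R\<^sup>2 / (\<theta> * \<eta>\<^sup>2) \<le> k" using k0 by (simp add: k_def)
      then show ?thesis using \<theta> \<eta> k by (simp add: pos_divide_le_eq mult_ac)
    qed
    have "\<forall>\<^sub>F n in sequentially. rc \<iota> (orbit_segment \<alpha> \<Omega> n) \<eta> \<le> exp (\<epsilon> / (4 * k) * n)"
      by (rule rc[OF \<Omega> \<eta>]) (use \<epsilon> k in simp)
    moreover have "\<forall>\<^sub>F n in sequentially. k * ln 4 / (\<epsilon> / 4) \<le> real n"
      using filterlim_real_sequentially unfolding filterlim_at_top by blast
    ultimately show "\<forall>\<^sub>F n in sequentially. \<exists>H. finite H \<and> card H \<le> exp (\<epsilon> * n)
        \<and> dual_net (orbit_segment \<alpha> \<Omega> n) \<delta> H"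
    proof eventually_elim
      case (elim n)
      define S where "S = orbit_segment \<alpha> \<Omega> n"
      have S: "finite S" unfolding S_def using \<Omega> by (rule finite_orbit_segment)
      have SR: "norm s \<le> R" if "s \<in> S" for s
        using norm_orbit_segment[OF \<alpha> R] that unfolding S_def by blast
      have cS: "card S \<le> M * n"
      proof -
        have "real (card S) \<le> real (n * card \<Omega>)"
          unfolding S_def using card_orbit_segment_le[OF \<Omega>] by (rule of_nat_mono)
        then show ?thesis by (simp add: M_def algebra_simps)
      qed
      define d where "d = rc \<iota> S \<eta>"
      obtain \<phi> \<psi> where CA: "(\<phi>, \<psi>, d) \<in> CA \<iota> S \<eta>"
        unfolding d_def using CA_rc[OF \<iota> S \<eta>] by blast
      have "isometric_embedding \<iota>" using \<iota> by (simp add: CA_embedding_def)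
      then obtain H where H: "finite H" "dual_net S (2 * \<eta>) H" and cH:
        "card H \<le> (4 * real d) ^ k
          * (exp (card Q * x * card S) / x powr (9 * R\<^sup>2 * card S / (k * \<eta>\<^sup>2)))"
        using CA_dual_net[where x = x and S = S and R = R, OF _ CA S SR Q k \<eta> x] by metis
      have "(4 * real d) ^ k \<le> (4 * exp (\<epsilon> / (4 * k) * n)) ^ k"
        using elim(1) by (intro power_mono) (auto simp: d_def S_def)
      also have "\<dots> = exp (k * (ln 4 + \<epsilon> / (4 * k) * n))"
        by (simp add: exp_of_nat_mult exp_add)
      also have "k * (ln 4 + \<epsilon> / (4 * k) * n) = k * ln 4 + \<epsilon> / 4 * n"
        using k by (simp add: field_simps)
      also have "exp \<dots> \<le> exp (\<epsilon> / 4 * n + \<epsilon> / 4 * n)"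
        using elim(2) \<epsilon> by (simp add: pos_divide_le_eq mult_ac)
      finally have 1: "(4 * real d) ^ k \<le> exp (\<epsilon> / 4 * n + \<epsilon> / 4 * n)" .
      have "card Q * x * card S \<le> card Q * x * (M * n)"
        using cS x by (intro mult_left_mono) auto
      also have "\<dots> = card Q * x * M * n" by simp
      also have "\<dots> \<le> \<epsilon> / 4 * n" using xQ by (intro mult_right_mono) auto
      finally have 2: "exp (card Q * x * card S) \<le> exp (\<epsilon> / 4 * n)" by simp
      have "9 * R\<^sup>2 * card S / (k * \<eta>\<^sup>2) = 9 * R\<^sup>2 / (k * \<eta>\<^sup>2) * card S" by simp
      also have "\<dots> \<le> \<theta> * (M * n)" using k\<theta> cS \<theta> by (intro mult_mono) auto
      finally have "9 * R\<^sup>2 * card S / (k * \<eta>\<^sup>2) * (- ln x) \<le> \<theta> * (M * n) * (- ln x)"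
        using lnx by (intro mult_right_mono) auto
      also have "\<dots> = \<theta> * M * (- ln x) * n" by simp
      also have "\<dots> \<le> \<epsilon> / 4 * n" using \<theta>x by (intro mult_right_mono) auto
      finally have 3: "1 / x powr (9 * R\<^sup>2 * card S / (k * \<eta>\<^sup>2)) \<le> exp (\<epsilon> / 4 * n)"
        using x by (simp add: powr_def exp_minus[symmetric] inverse_eq_divide[symmetric])
      have "card H \<le> (4 * real d) ^ k
          * (exp (card Q * x * card S) * (1 / x powr (9 * R\<^sup>2 * card S / (k * \<eta>\<^sup>2))))"
        using cH by simp
      also have "\<dots> \<le> exp (\<epsilon> / 4 * n + \<epsilon> / 4 * n) * (exp (\<epsilon> / 4 * n) * exp (\<epsilon> / 4 * n))"
        using 1 2 3 by (intro mult_mono) auto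
      also have "\<dots> = exp (\<epsilon> * n)" by (simp add: exp_add[symmetric])
      finally show ?case using H by (auto simp: S_def \<eta>_def)
    qed
  qed
qed

section \<open>Invariance under isomorphism\<close>

text \<open>
  Composing a functional of norm at most \<open>1\<close> with \<open>inv \<gamma>\<close> and dividing by a bound \<open>L\<close> for \<open>inv \<gamma>\<close> gives a
  functional of norm at most \<open>1\<close> on the other space. Since \<open>\<gamma>\<close> maps orbits to orbits, a
  \<open>\<delta> / L\<close>-net there pulls back to a \<open>\<delta>\<close>-net of the same size.
\<close>

lemma subexponential_dual_nets_transfer:
  fixes \<gamma> :: "'a::complex_banach \<Rightarrow> 'b::complex_banach"
  assumes \<gamma>: "banach_isomorphism \<gamma>" and comm: "\<gamma> \<circ> \<alpha> = \<beta> \<circ> \<gamma>"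
    and nets: "subexponential_dual_nets \<beta>"
  shows "subexponential_dual_nets \<alpha>"
  unfolding subexponential_dual_nets_def
proof (intro allI impI)
  fix \<Omega> :: "'a set" and \<delta> \<epsilon> :: real assume \<Omega>: "finite \<Omega>" and \<delta>: "\<delta> > 0" and \<epsilon>: "\<epsilon> > 0"
  have "bij \<gamma>" and inv: "bounded_linear (inv \<gamma>)" "\<And>c y. inv \<gamma> (c *\<^sub>C y) = c *\<^sub>C inv \<gamma> y"
    using \<gamma> by (auto simp: banach_isomorphism_def bounded_clinear_def)
  then have inv_\<gamma>: "inv \<gamma> (\<gamma> x) = x" for x by (simp add: bij_is_inj)
  obtain L where L: "L > 0" "\<And>y. norm (inv \<gamma> y) \<le> norm y * L"
    using bounded_linear.pos_bounded[OF inv(1)] by blast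
  have "\<gamma> ((\<alpha> ^^ j) x) = (\<beta> ^^ j) (\<gamma> x)" for j x
    using comm by (induction j) (simp_all add: fun_eq_iff)
  then have orbit: "orbit_segment \<beta> (\<gamma> ` \<Omega>) n = \<gamma> ` orbit_segment \<alpha> \<Omega> n" for n
    by (simp add: orbit_segment_def image_UN image_image)
  have "\<forall>\<^sub>F n in sequentially. \<exists>H. finite H \<and> card H \<le> exp (\<epsilon> * n)
      \<and> dual_net (orbit_segment \<beta> (\<gamma> ` \<Omega>) n) (\<delta> / L) H"
    using nets \<Omega> \<delta> \<epsilon> L(1) unfolding subexponential_dual_nets_def by simp
  then show "\<forall>\<^sub>F n in sequentially. \<exists>H. finite H \<and> card H \<le> exp (\<epsilon> * n)
      \<and> dual_net (orbit_segment \<alpha> \<Omega> n) \<delta> H"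
  proof eventually_elim
    case (elim n)
    then obtain H where H: "finite H" "card H \<le> exp (\<epsilon> * n)"
      and net: "dual_net (\<gamma> ` orbit_segment \<alpha> \<Omega> n) (\<delta> / L) H" unfolding orbit by blast
    define pull where "pull h x = of_real L * h (\<gamma> x)" for h :: "'b \<Rightarrow> complex" and x
    have "dual_net (orbit_segment \<alpha> \<Omega> n) \<delta> (pull ` H)"
      unfolding dual_net_def
    proof
      fix f :: "'a \<Rightarrow> complex" assume f: "f \<in> dual_ball"
      define g where "g y = f (inv \<gamma> y) / of_real L" for y
      have "cmod (f (inv \<gamma> y)) \<le> norm y * L" for y
        using f L(2)[of y] unfolding dual_ball_def by (blast intro: order_trans)
      then have "g \<in> dual_ball"
        using f L(1) linear_add[OF bounded_linear.linear[OF inv(1)]]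
        by (simp add: dual_ball_def g_def inv(2) norm_divide pos_divide_le_eq add_divide_distrib)
      then obtain h where h: "h \<in> H"
        "\<And>x. x \<in> orbit_segment \<alpha> \<Omega> n \<Longrightarrow> cmod (g (\<gamma> x) - h (\<gamma> x)) < \<delta> / L"
        using net unfolding dual_net_def by blast
      have "cmod (f x - pull h x) < \<delta>" if "x \<in> orbit_segment \<alpha> \<Omega> n" for x
      proof -
        have "f x - pull h x = of_real L * (g (\<gamma> x) - h (\<gamma> x))"
          using L(1) by (simp add: pull_def g_def inv_\<gamma> right_diff_distrib)
        then have "cmod (f x - pull h x) = L * cmod (g (\<gamma> x) - h (\<gamma> x))"
          using L(1) by (simp add: norm_mult)
        then show ?thesis using h(2)[OF that] L(1) by (simp add: pos_less_divide_eq mult.commute)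
      qed
      then show "\<exists>h\<in>pull ` H. \<forall>x\<in>orbit_segment \<alpha> \<Omega> n. cmod (f x - h x) < \<delta>"
        using h(1) by blast
    qed
    moreover have "card (pull ` H) \<le> exp (\<epsilon> * n)"
      using card_image_le[OF H(1), of pull] H(2) by linarith
    ultimately show ?case using H(1) by blast
  qed
qed

lemma banach_isomorphism_inv: "banach_isomorphism \<gamma> \<Longrightarrow> banach_isomorphism (inv \<gamma>)"
  by (simp add: banach_isomorphism_def bij_imp_bij_inv inv_inv_eq)

theorem corollary3p8:
  fixes \<alpha>1 :: "'x1::complex_banach \<Rightarrow> 'x1"
    and \<alpha>2 :: "'x2::complex_banach \<Rightarrow> 'x2"
    and \<gamma> :: "'x1 \<Rightarrow> 'x2"
    and \<iota>1 :: "'x1 \<Rightarrow> 'y1::complex_banach"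
    and \<iota>2 :: "'x2 \<Rightarrow> 'y2::complex_banach"
  assumes "CA_embedding \<iota>1" and "CA_embedding \<iota>2"
    and "isometric_automorphism \<alpha>1" and "isometric_automorphism \<alpha>2"
    and "banach_isomorphism \<gamma>"
    and "\<gamma> \<circ> \<alpha>1 = \<alpha>2 \<circ> \<gamma>"
  shows "hc \<iota>1 \<alpha>1 = 0 \<longleftrightarrow> hc \<iota>2 \<alpha>2 = 0"
proof -
  have "bij \<gamma>" using assms(5) by (simp add: banach_isomorphism_def)
  have "inv \<gamma> \<circ> \<alpha>2 = \<alpha>1 \<circ> inv \<gamma>"
  proof
    fix y
    have "\<alpha>2 y = \<alpha>2 (\<gamma> (inv \<gamma> y))" using \<open>bij \<gamma>\<close> by (simp add: bij_is_surj surj_f_inv_f)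
    also have "\<dots> = \<gamma> (\<alpha>1 (inv \<gamma> y))" using assms(6) by (simp add: fun_eq_iff)
    finally show "(inv \<gamma> \<circ> \<alpha>2) y = (\<alpha>1 \<circ> inv \<gamma>) y" using \<open>bij \<gamma>\<close> by (simp add: bij_is_inj)
  qed
  then have "subexponential_dual_nets \<alpha>1 \<longleftrightarrow> subexponential_dual_nets \<alpha>2"
    using subexponential_dual_nets_transfer[OF assms(5,6)]
      subexponential_dual_nets_transfer[OF banach_isomorphism_inv[OF assms(5)]] by blast
  then show ?thesis
    using hc_eq_0_iff_subexponential_dual_nets[OF assms(1,3)]
      hc_eq_0_iff_subexponential_dual_nets[OF assms(2,4)] by simp
qed

end
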